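(* Let $n\ge 2$, $0\le m\le n$, let $P=(p_{jk})$ be an $n\times n$-matrix with real entries and $P_{abs}=(|p_{jk}|)$. Then the following statements are equivalent: (i) the problem $$\partial_t u_j + a_j(x,t)\partial_x u_j + b_j(x,t)u_j = 0,\quad 0<x<1,\ t>0,\ j\le n,$$ $$u_j(0,t) = \sum_{k=1}^m p_{jk}u_k(1,t)+\sum_{k=m+1}^n p_{jk}u_k(0,t),\quad t\ge 0,\ 1\le j\le m,$$ $$u_j(1,t) = \sum_{k=1}^m p_{jk}u_k(1,t)+\sum_{k=m+1}^n p_{jk}u_k(0,t),\quad t\ge 0,\ m<j\le n,$$ $$u_j(x,0)=\varphi_j(x),\quad 0\le x\le 1,\ j\le n,$$ is robust finite time stabilizable; (ii) the products $p_{i_1i_2}p_{i_2i_3}\cdots p_{i_ni_{n+1}}$ are equal to zero for all tuples $(i_1,\dots,i_{n+1})\in\{1,\dots,n\}^{n+1}$; (iii) all principal minors of the matrix $P$ equal zero; (iv) the matrix $P_{abs}$ is nilpotent, with $P_{abs}^n=0$.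
   Context: Let $\Pi=\{(x,t): 0\le x\le 1,\ 0\le t<\infty\}$. All functions are real-valued; $L^2(0,1)^n$ is normed by $\|u\|=\max_{j\le n}\|u_j\|_{L^2(0,1)}$. Admissible coefficients: (a) there is $a>0$ with $a_j\ge a$ on $\Pi$ for $1\le j\le m$ and $a_j\le -a$ on $\Pi$ for $m+1\le j\le n$; (b) $a_j,b_j\in C^1(\Pi)$ are bounded in $\Pi$ together with their first order derivatives. $C_0^\infty([0,1])$ is the space of functions in $C^\infty([0,1])$ with support within $(0,1)$. For admissible coefficients and $\varphi\in C_0^\infty([0,1])^n$ the problem has a unique classical $C^1$-solution in $\Pi$. For $\varphi\in L^2(0,1)^n$, a function $u\in C([0,\infty),L^2(0,1))^n$ is an $L^2$-generalized solution if for any sequence $\varphi^l\in C_0^\infty([0,1])^n$ with $\varphi^l\to\varphi$ in $L^2(0,1)^n$, the classical $C^1$-solutions $u^l$ with initial data $\varphi^l$ satisfy $\|u(\cdot,t)-u^l(\cdot,t)\|_{L^2(0,1)^n}\to 0$ as $l\to\infty$, uniformly in $t\in[0,T]$ for each $T>0$. For every $\varphi\in L^2(0,1)^n$ there is a unique $L^2$-generalized solution. The problem is finite time stabilizable (FTS) if there exists $T_e>0$ such that for every $\varphi\in L^2(0,1)^n$ the $L^2$-generalized solution is zero for all $t>T_e$. It is robust FTS if it is FTS for any admissible coefficients $a_j,b_j$ (with $m$ and $P$ fixed). A principal minor of an $n\times n$ matrix is the determinant of its restriction to the rows and columns with the same set of indices $j_1<\dots<j_l$, $1\le l\le n$. 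*)

theory Defs
  imports "HOL-Analysis.Analysis" "Jordan_Normal_Form.Determinant" "Jordan_Normal_Form.DL_Submatrix"
begin

text \<open>
  Components and matrix indices are numbered from 0: the index \<open>j < n\<close> stands for the index
  \<open>j + 1\<close> of the usual numbering, so \<open>j < m\<close> selects the components with positive speed.
\<close>

definition strip :: "(real \<times> real) set" where
  "strip = {0..1} \<times> {0..}"

text \<open>
  \<open>f\<close> is of class $C^1$ up to the boundary of the strip, with partial derivatives \<open>fx\<close>
  and \<open>ft\<close>; these are one-sided on the boundary, and uniquely determined on \<open>strip\<close>.
\<close>

definition C1_strip ::
  "(real \<times> real \<Rightarrow> real) \<Rightarrow> (real \<times> real \<Rightarrow> real) \<Rightarrow> (real \<times> real \<Rightarrow> real) \<Rightarrow> bool" where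
  "C1_strip f fx ft \<longleftrightarrow>
     continuous_on strip fx \<and> continuous_on strip ft \<and>
     (\<forall>p\<in>strip. (f has_derivative (\<lambda>(h, k). fx p * h + ft p * k)) (at p within strip))"

definition bounded_C1_strip :: "(real \<times> real \<Rightarrow> real) \<Rightarrow> bool" where
  "bounded_C1_strip f \<longleftrightarrow>
     (\<exists>fx ft. C1_strip f fx ft \<and> bounded (f ` strip) \<and> bounded (fx ` strip) \<and> bounded (ft ` strip))"

definition admissible ::
  "nat \<Rightarrow> nat \<Rightarrow> (nat \<Rightarrow> real \<times> real \<Rightarrow> real) \<Rightarrow> (nat \<Rightarrow> real \<times> real \<Rightarrow> real) \<Rightarrow> bool" where
  "admissible n m a b \<longleftrightarrow>
     (\<exists>a0>0. (\<forall>j<m. \<forall>p\<in>strip. a j p \<ge> a0) \<and> (\<forall>j\<in>{m..<n}. \<forall>p\<in>strip. a j p \<le> - a0)) \<and>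
     (\<forall>j<n. bounded_C1_strip (a j) \<and> bounded_C1_strip (b j))"

definition L2_fun :: "(real \<Rightarrow> real) \<Rightarrow> bool" where
  "L2_fun f \<longleftrightarrow>
     f \<in> borel_measurable (lebesgue_on {0<..<1}) \<and> integrable (lebesgue_on {0<..<1}) (\<lambda>x. (f x)\<^sup>2)"

definition L2_norm :: "(real \<Rightarrow> real) \<Rightarrow> real" where
  "L2_norm f = sqrt (\<integral>x. (f x)\<^sup>2 \<partial>(lebesgue_on {0<..<1}))"

definition L2_norm_n :: "nat \<Rightarrow> (nat \<Rightarrow> real \<Rightarrow> real) \<Rightarrow> real" where
  "L2_norm_n n f = (MAX j\<in>{..<n}. L2_norm (f j))"

text \<open>
  \<open>D k\<close> is the \<open>k\<close>-th derivative on the closed unit interval, one-sided at the end points.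
\<close>

definition C0_infinity :: "(real \<Rightarrow> real) \<Rightarrow> bool" where
  "C0_infinity f \<longleftrightarrow>
     (\<exists>D :: nat \<Rightarrow> real \<Rightarrow> real.
        (\<forall>x\<in>{0..1}. D 0 x = f x) \<and>
        (\<forall>k. \<forall>x\<in>{0..1}. (D k has_real_derivative D (Suc k) x) (at x within {0..1}))) \<and>
     closure {x\<in>{0..1}. f x \<noteq> 0} \<subseteq> {0<..<1}"

definition classical_solution ::
  "nat \<Rightarrow> nat \<Rightarrow> real mat \<Rightarrow> (nat \<Rightarrow> real \<times> real \<Rightarrow> real) \<Rightarrow> (nat \<Rightarrow> real \<times> real \<Rightarrow> real) \<Rightarrow>
   (nat \<Rightarrow> real \<Rightarrow> real) \<Rightarrow> (nat \<Rightarrow> real \<times> real \<Rightarrow> real) \<Rightarrow> bool" where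
  "classical_solution n m P a b \<phi> u \<longleftrightarrow>
     (\<forall>j<n. \<exists>ux ut. C1_strip (u j) ux ut \<and>
        (\<forall>x t. 0 < x \<and> x < 1 \<and> 0 < t \<longrightarrow>
           ut (x, t) + a j (x, t) * ux (x, t) + b j (x, t) * u j (x, t) = 0)) \<and>
     (\<forall>j<m. \<forall>t\<ge>0.
        u j (0, t) = (\<Sum>k<m. P $$ (j, k) * u k (1, t)) + (\<Sum>k=m..<n. P $$ (j, k) * u k (0, t))) \<and>
     (\<forall>j\<in>{m..<n}. \<forall>t\<ge>0.
        u j (1, t) = (\<Sum>k<m. P $$ (j, k) * u k (1, t)) + (\<Sum>k=m..<n. P $$ (j, k) * u k (0, t))) \<and>
     (\<forall>j<n. \<forall>x\<in>{0..1}. u j (x, 0) = \<phi> j x)"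

definition continuous_L2 :: "(real \<times> real \<Rightarrow> real) \<Rightarrow> bool" where
  "continuous_L2 v \<longleftrightarrow>
     (\<forall>t\<ge>0. L2_fun (\<lambda>x. v (x, t))) \<and>
     (\<forall>t\<ge>0. ((\<lambda>s. L2_norm (\<lambda>x. v (x, s) - v (x, t))) \<longlongrightarrow> 0) (at t within {0..}))"

text \<open>
  Classical solutions with initial data in $C_0^\infty([0,1])^n$ exist and are unique on \<open>strip\<close>,
  so the existentially quantified \<open>ul\<close> below is the sequence of the classical solutions.
\<close>

definition L2_generalized_solution ::
  "nat \<Rightarrow> nat \<Rightarrow> real mat \<Rightarrow> (nat \<Rightarrow> real \<times> real \<Rightarrow> real) \<Rightarrow> (nat \<Rightarrow> real \<times> real \<Rightarrow> real) \<Rightarrow>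
   (nat \<Rightarrow> real \<Rightarrow> real) \<Rightarrow> (nat \<Rightarrow> real \<times> real \<Rightarrow> real) \<Rightarrow> bool" where
  "L2_generalized_solution n m P a b \<phi> u \<longleftrightarrow>
     (\<forall>j<n. continuous_L2 (u j)) \<and>
     (\<forall>\<phi>l :: nat \<Rightarrow> nat \<Rightarrow> real \<Rightarrow> real.
        (\<forall>l. \<forall>j<n. C0_infinity (\<phi>l l j)) \<longrightarrow>
        (\<lambda>l. L2_norm_n n (\<lambda>j x. \<phi>l l j x - \<phi> j x)) \<longlonglongrightarrow> 0 \<longrightarrow>
        (\<exists>ul. (\<forall>l. classical_solution n m P a b (\<phi>l l) (ul l)) \<and>
           (\<forall>T>0. uniform_limit {0..T}
              (\<lambda>l t. L2_norm_n n (\<lambda>j x. u j (x, t) - ul l j (x, t))) (\<lambda>t. 0) sequentially)))"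

definition finite_time_stabilizable ::
  "nat \<Rightarrow> nat \<Rightarrow> real mat \<Rightarrow> (nat \<Rightarrow> real \<times> real \<Rightarrow> real) \<Rightarrow> (nat \<Rightarrow> real \<times> real \<Rightarrow> real) \<Rightarrow> bool" where
  "finite_time_stabilizable n m P a b \<longleftrightarrow>
     (\<exists>Te>0. \<forall>\<phi> u. (\<forall>j<n. L2_fun (\<phi> j)) \<longrightarrow> L2_generalized_solution n m P a b \<phi> u \<longrightarrow>
        (\<forall>t>Te. \<forall>j<n. AE x in lebesgue_on {0<..<1}. u j (x, t) = 0))"

definition robust_finite_time_stabilizable :: "nat \<Rightarrow> nat \<Rightarrow> real mat \<Rightarrow> bool" where
  "robust_finite_time_stabilizable n m P \<longleftrightarrow>
     (\<forall>a b. admissible n m a b \<longrightarrow> finite_time_stabilizable n m P a b)"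

definition principal_minor :: "real mat \<Rightarrow> nat set \<Rightarrow> real" where
  "principal_minor A J = Determinant.det (submatrix A J J)"

definition nilpotent_mat :: "real mat \<Rightarrow> bool" where
  "nilpotent_mat A \<longleftrightarrow> (\<exists>k>0. A ^\<^sub>m k = 0\<^sub>m (dim_row A) (dim_row A))"

end

theory Submission
  imports Defs
begin

text \<open>
  Draw an edge from \<open>j\<close> to \<open>k\<close> whenever $p_{jk} \neq 0$, and call a nonempty index set recurrent
  if each of its elements has an edge into the set. All four statements say that no recurrent
  set exists, in other words that the graph is acyclic.

  For the products and for \<open>P_abs\<close> this is the pigeonhole principle: a walk with \<open>n\<close> steps visits
  some index twice, and the entries of \<open>P_abs ^\<^sub>m n\<close> are sums, without cancellation, of the weights
  of the walks with \<open>n\<close> steps. For the minors, a nonzero term of the Leibniz expansion makes its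
  index set recurrent; conversely, in a recurrent set of least cardinality every index has exactly
  one successor and the successor map is a bijection (\<open>minimal_recurrent_set\<close>), so that the
  expansion of its minor has exactly one nonzero term.

  If the graph is acyclic, finite time extinction holds for all admissible coefficients. A wave
  crosses the strip within the time \<open>1 / a0\<close>, and what enters in component \<open>j\<close> is combined from the
  outflow of the successors of \<open>j\<close>. By induction on \<open>s\<close>, component \<open>j\<close> is extinct at time \<open>s / a0\<close>
  if no walk with \<open>s\<close> steps starts in \<open>j\<close>; hence everything is extinct at time \<open>n / a0\<close>
  (\<open>classical_solution_vanishes\<close>). The transport equation enters only through a maximum principle
  (\<open>transport_nonpos\<close>), which avoids the construction of characteristics. Density of the test
  functions in $L^2$ carries extinction over to generalized solutions.

  If there is a recurrent set, it is enough to look at speeds $\pm 1$ and constant damping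
  coefficients $\beta_k \ge 0$. Every crossing then takes the time 1 and multiplies component \<open>k\<close>
  by $e^{-\beta_k}$, so the vector of inflow traces satisfies $v(t) = A\, v(t - 1)$ with
  $A = P\, \mathrm{diag}(e^{-\beta_k})$. The solutions are explicit (\<open>wave\<close>), and extinction forces
  some power of \<open>A\<close> to vanish. The damping is needed because \<open>P\<close> itself can be nilpotent by
  cancellation, as for the rows $(1, 1)$ and $(-1, -1)$. Take a minimal recurrent set \<open>J\<close>, the
  damping factor 1 on \<open>J\<close> and a factor $\varepsilon \in (0, 1)$ off \<open>J\<close>. The exponent of the vanishing
  power may depend on $\varepsilon$, but one exponent serves infinitely many $\varepsilon$; as the entries
  of the power are polynomials in $\varepsilon$, it also serves $\varepsilon = 0$. There the matrix maps
  each index of \<open>J\<close> to its unique successor, and no power of it vanishes.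
\<close>

section \<open>Recurrent index sets\<close>

lemma pow_mat_Suc_left:
  assumes "A \<in> carrier_mat n n"
  shows "A ^\<^sub>m Suc s = A * A ^\<^sub>m s"
proof (induction s)
  case (Suc s)
  have "A ^\<^sub>m Suc (Suc s) = (A * A ^\<^sub>m s) * A"
    using Suc by simp
  also have "\<dots> = A * A ^\<^sub>m Suc s"
    using assms by (simp add: assoc_mult_mat[of _ n n _ n _ n])
  finally show ?case .
qed (use assms in simp)

lemma pow_mat_Suc_left_entry:
  fixes A :: "real mat"
  assumes "A \<in> carrier_mat n n" "j < n" "l < n"
  shows "(A ^\<^sub>m Suc s) $$ (j, l) = (\<Sum>k<n. A $$ (j, k) * (A ^\<^sub>m s) $$ (k, l))"
proof -
  have "A ^\<^sub>m s \<in> carrier_mat n n" using assms by simp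
  then show ?thesis
    unfolding pow_mat_Suc_left[OF assms(1)] using assms
    by (simp add: scalar_prod_def lessThan_atLeast0)
qed

definition recurrent_set :: "real mat \<Rightarrow> nat set \<Rightarrow> bool" where
  "recurrent_set P J \<longleftrightarrow> J \<noteq> {} \<and> (\<forall>j\<in>J. \<exists>k\<in>J. P $$ (j, k) \<noteq> 0)"

text \<open>
  Iterating a choice of successors gives arbitrarily long walks inside a recurrent set. Conversely,
  a walk through \<open>n + 1\<close> positions repeats an index, and the indices between two visits form a
  recurrent set.
\<close>

lemma recurrent_set_iff_walk:
  "(\<exists>J\<subseteq>{..<n}. recurrent_set P J) \<longleftrightarrow>
   (\<exists>i\<in>{1..n + 1} \<rightarrow> {..<n}. (\<Prod>k=1..n. P $$ (i k, i (k + 1))) \<noteq> 0)"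
proof
  assume "\<exists>J\<subseteq>{..<n}. recurrent_set P J"
  then obtain J where J: "J \<subseteq> {..<n}" "J \<noteq> {}" "\<forall>j\<in>J. \<exists>k\<in>J. P $$ (j, k) \<noteq> 0"
    by (auto simp: recurrent_set_def)
  then obtain f where f: "\<And>j. j \<in> J \<Longrightarrow> f j \<in> J \<and> P $$ (j, f j) \<noteq> 0"
    by metis
  obtain j0 where "j0 \<in> J" using J by auto
  then have it: "(f ^^ k) j0 \<in> J" for k
    by (induction k) (use f in auto)
  have "(\<lambda>k. (f ^^ k) j0) \<in> {1..n + 1} \<rightarrow> {..<n}"
    using it J by blast
  moreover have "(\<Prod>k=1..n. P $$ ((f ^^ k) j0, (f ^^ (k + 1)) j0)) \<noteq> 0"
    using f it by auto
  ultimately show "\<exists>i\<in>{1..n + 1} \<rightarrow> {..<n}. (\<Prod>k=1..n. P $$ (i k, i (k + 1))) \<noteq> 0"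
    by (intro bexI[of _ "\<lambda>k. (f ^^ k) j0"])
next
  assume "\<exists>i\<in>{1..n + 1} \<rightarrow> {..<n}. (\<Prod>k=1..n. P $$ (i k, i (k + 1))) \<noteq> 0"
  then obtain i where i: "i \<in> {1..n + 1} \<rightarrow> {..<n}"
    and "(\<Prod>k=1..n. P $$ (i k, i (k + 1))) \<noteq> 0"
    by blast
  then have nz: "P $$ (i k, i (Suc k)) \<noteq> 0" if "1 \<le> k" "k \<le> n" for k
    using that by auto
  have "\<not> inj_on i {1..n + 1}"
  proof
    assume "inj_on i {1..n + 1}"
    then have "card {1..n + 1} \<le> card {..<n}"
      by (intro card_inj_on_le[of i]) (use i in auto)
    then show False by simp
  qed
  then obtain a b where ab: "1 \<le> a" "a < b" "b \<le> n + 1" "i a = i b"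
    unfolding inj_on_def by (metis atLeastAtMost_iff linorder_neqE_nat)
  have "recurrent_set P (i ` {a..<b})"
    unfolding recurrent_set_def
  proof (intro conjI ballI)
    show "i ` {a..<b} \<noteq> {}" using ab by auto
    fix j assume "j \<in> i ` {a..<b}"
    then obtain k where k: "a \<le> k" "k < b" "j = i k" by auto
    have "i (Suc k) \<in> i ` {a..<b}"
    proof (cases "Suc k = b")
      case True
      then show ?thesis using ab by (metis atLeastLessThan_iff image_eqI order_refl)
    next
      case False
      then show ?thesis using k by auto
    qed
    then show "\<exists>l\<in>i ` {a..<b}. P $$ (j, l) \<noteq> 0"
      using nz[of k] k ab by auto
  qed
  moreover have "i ` {a..<b} \<subseteq> {..<n}"
    using i ab by auto
  ultimately show "\<exists>J\<subseteq>{..<n}. recurrent_set P J" by blast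
qed

text \<open>
  Take a recurrent set of least cardinality. The image of any choice of successors is again
  recurrent, hence the whole set, so every such choice is a bijection. If some \<open>j\<close> had two
  successors, changing the choice at \<open>j\<close> alone would destroy injectivity.
\<close>

lemma minimal_recurrent_set:
  assumes "\<exists>J\<subseteq>{..<n}. recurrent_set P J"
  obtains J f where "J \<subseteq> {..<n}" "J \<noteq> {}" "bij_betw f J J"
    "\<And>j k. j \<in> J \<Longrightarrow> k \<in> J \<Longrightarrow> P $$ (j, k) \<noteq> 0 \<longleftrightarrow> k = f j"
proof -
  define Q where "Q J \<longleftrightarrow> J \<subseteq> {..<n} \<and> recurrent_set P J" for J
  obtain J where J: "Q J" and min: "\<And>K. Q K \<Longrightarrow> card J \<le> card K"
    using ex_has_least_nat[of Q _ card] assms unfolding Q_def by metis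
  have sub: "J \<subseteq> {..<n}" "J \<noteq> {}" and rec: "\<And>j. j \<in> J \<Longrightarrow> \<exists>k\<in>J. P $$ (j, k) \<noteq> 0"
    using J by (auto simp: Q_def recurrent_set_def)
  have fin: "finite J" using sub finite_subset by blast
  have bij: "bij_betw g J J" if g: "\<And>j. j \<in> J \<Longrightarrow> g j \<in> J \<and> P $$ (j, g j) \<noteq> 0" for g
  proof -
    have "Q (g ` J)"
      unfolding Q_def recurrent_set_def using g sub by blast
    then have "card J \<le> card (g ` J)" by (rule min)
    then have "g ` J = J"
      using g fin by (intro card_subset_eq) (auto intro: antisym card_mono)
    then show ?thesis
      using fin by (simp add: bij_betw_def eq_card_imp_inj_on)
  qed
  obtain f where f: "\<And>j. j \<in> J \<Longrightarrow> f j \<in> J \<and> P $$ (j, f j) \<noteq> 0"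
    using rec by metis
  have uniq: "k = f j" if "j \<in> J" "k \<in> J" "P $$ (j, k) \<noteq> 0" for j k
  proof (rule ccontr)
    assume ne: "k \<noteq> f j"
    have bf: "bij_betw f J J" by (rule bij) (rule f)
    then have "k \<in> f ` J" using that by (simp add: bij_betw_def)
    then obtain i where i: "i \<in> J" "f i = k" by blast
    then have "i \<noteq> j" using ne by auto
    have "bij_betw (f(j := k)) J J"
      by (rule bij) (use f that in auto)
    then have "inj_on (f(j := k)) J" by (simp add: bij_betw_def)
    from inj_onD[OF this, of i j] show False
      using i \<open>i \<noteq> j\<close> \<open>j \<in> J\<close> by auto
  qed
  show thesis
  proof (rule that[of J f])
    show "bij_betw f J J" by (rule bij) (rule f)
    show "P $$ (j, k) \<noteq> 0 \<longleftrightarrow> k = f j" if "j \<in> J" "k \<in> J" for j k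
      using uniq[of j k] f[of j] that by metis
  qed (use sub in auto)
qed

text \<open>
  The Leibniz expansion, transported to the indices of \<open>J\<close> by their increasing enumeration.
\<close>

lemma principal_minor_eq_sum:
  assumes "P \<in> carrier_mat n n" "J \<subseteq> {..<n}"
  shows "principal_minor P J =
    (\<Sum>p | p permutes {0..<card J}. signof p * (\<Prod>i=0..<card J. P $$ (pick J i, pick J (p i))))"
proof -
  have *: "{i. i < n \<and> i \<in> J} = J" using assms(2) by auto
  have c: "submatrix P J J \<in> carrier_mat (card J) (card J)"
    using assms(1) * by (intro carrier_matI) (simp_all only: dim_submatrix carrier_matD)
  show ?thesis
    unfolding principal_minor_def det_def'[OF c]
  proof (intro sum.cong refl arg_cong2[where f="(*)"] prod.cong)
    fix p i assume "p \<in> {p. p permutes {0..<card J}}" and i: "i \<in> {0..<card J}"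
    then have "p i \<in> {0..<card J}" using permutes_in_image by fastforce
    then show "submatrix P J J $$ (i, p i) = P $$ (pick J i, pick J (p i))"
      using i assms(1) * by (intro submatrix_index) auto
  qed
qed

lemma bij_betw_pick:
  assumes "finite J"
  shows "bij_betw (pick J) {0..<card J} J"
proof -
  have "inj_on (pick J) {0..<card J}"
    using pick_mono[where S=J] by (intro linorder_inj_onI) (auto, metis less_irrefl)
  moreover have "pick J ` {0..<card J} \<subseteq> J"
    using pick_in_set[where S=J] by auto
  ultimately show ?thesis
    using assms by (simp add: bij_betw_def card_image card_subset_eq)
qed

lemma recurrent_set_of_principal_minor:
  assumes "P \<in> carrier_mat n n" "J \<subseteq> {..<n}" "J \<noteq> {}" "principal_minor P J \<noteq> 0"
  shows "recurrent_set P J"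
proof -
  have fin: "finite J" using assms(2) finite_subset by blast
  obtain p where p: "p permutes {0..<card J}"
    and nz: "(\<Prod>i=0..<card J. P $$ (pick J i, pick J (p i))) \<noteq> 0"
    using assms(4) unfolding principal_minor_eq_sum[OF assms(1,2)]
    by (metis (mono_tags, lifting) mem_Collect_eq mult_zero_right sum.not_neutral_contains_not_neutral)
  have img: "pick J ` {0..<card J} = J"
    using bij_betw_pick[OF fin] by (simp add: bij_betw_def)
  have "\<exists>k\<in>J. P $$ (j, k) \<noteq> 0" if "j \<in> J" for j
  proof -
    have "j \<in> pick J ` {0..<card J}" using that img by simp
    then obtain i where i: "i \<in> {0..<card J}" "j = pick J i" by (rule imageE)
    then have "p i \<in> {0..<card J}" using p permutes_in_image by fastforce
    then have "pick J (p i) \<in> J" using img by blast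
    moreover have "P $$ (j, pick J (p i)) \<noteq> 0" using nz i by simp
    ultimately show ?thesis by blast
  qed
  then show ?thesis using assms(3) by (simp add: recurrent_set_def)
qed

text \<open>
  In the Leibniz expansion only the permutation that follows the successor map contributes.
\<close>

lemma principal_minor_unique_successor:
  assumes "P \<in> carrier_mat n n" "J \<subseteq> {..<n}" "bij_betw f J J"
    and f: "\<And>j k. j \<in> J \<Longrightarrow> k \<in> J \<Longrightarrow> P $$ (j, k) \<noteq> 0 \<longleftrightarrow> k = f j"
  shows "principal_minor P J \<noteq> 0"
proof -
  have fin: "finite J" using assms(2) finite_subset by blast
  let ?c = "{0..<card J}"
  have pick: "bij_betw (pick J) ?c J" by (rule bij_betw_pick[OF fin])
  then have pickJ: "pick J i \<in> J" if "i < card J" for i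
    using that by (auto simp: bij_betw_def)
  \<comment> \<open>The successor map, transported from \<open>J\<close> to the positions in its enumeration.\<close>
  define q where "q = (\<lambda>i. if i \<in> ?c then inv_into ?c (pick J) (f (pick J i)) else i)"
  have "bij_betw (inv_into ?c (pick J) \<circ> (f \<circ> pick J)) ?c ?c"
    by (intro bij_betw_trans[of _ _ J] bij_betw_inv_into pick assms(3))
  then have "bij_betw q ?c ?c"
    by (rule bij_betw_cong[THEN iffD1, rotated]) (auto simp: q_def)
  then have q: "q permutes ?c"
    by (rule bij_imp_permutes) (simp add: q_def)
  have fJ: "f j \<in> J" if "j \<in> J" for j using that assms(3) by (auto simp: bij_betw_def)
  have pq: "pick J (q i) = f (pick J i)" if "i < card J" for i
    using that fJ[OF pickJ[OF that]] pick by (simp add: q_def bij_betw_inv_into_right)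
  have zero: "(\<Prod>i=0..<card J. P $$ (pick J i, pick J (p i))) = 0"
    if p: "p permutes ?c" and "p \<noteq> q" for p
  proof -
    obtain i where i: "p i \<noteq> q i" using \<open>p \<noteq> q\<close> by (meson ext)
    then have ic: "i \<in> ?c" using p q by (metis permutes_def)
    have "p i \<in> ?c" "q i \<in> ?c" using p q ic by (meson permutes_in_image)+
    then have "pick J (p i) \<noteq> pick J (q i)"
      using i pick by (metis bij_betw_inv_into_left)
    then have "P $$ (pick J i, pick J (p i)) = 0"
      using f[of "pick J i" "pick J (p i)"] pq[of i] pickJ ic \<open>p i \<in> ?c\<close> by auto
    then show ?thesis using ic by auto
  qed
  have "principal_minor P J =
      (\<Sum>p\<in>{q}. signof p * (\<Prod>i=0..<card J. P $$ (pick J i, pick J (p i))))"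
    unfolding principal_minor_eq_sum[OF assms(1,2)]
    by (rule sum.mono_neutral_right) (use q zero in \<open>auto simp: finite_permutations\<close>)
  also have "\<dots> \<noteq> 0"
    using pq fJ f pickJ by (auto simp: sign_def)
  finally show ?thesis .
qed

lemma abs_power_nonneg:
  fixes P :: "real mat"
  assumes P: "P \<in> carrier_mat n n" and "j < n" "l < n"
  shows "0 \<le> (map_mat abs P ^\<^sub>m s) $$ (j, l)"
  using assms(2,3)
proof (induction s arbitrary: j)
  case 0
  then show ?case using P by (cases "j = l") auto
next
  case (Suc s)
  have A: "map_mat abs P \<in> carrier_mat n n" using P by simp
  show ?case
    unfolding pow_mat_Suc_left_entry[OF A Suc.prems]
    using Suc P by (intro sum_nonneg mult_nonneg_nonneg) auto
qed

text \<open>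
  If no walk with \<open>s + 1\<close> steps starts in \<open>j\<close>, then none with \<open>s\<close> steps starts in a successor of \<open>j\<close>.
  Taking absolute values excludes cancellation, so vanishing rows of the powers express this.
\<close>

lemma abs_power_row_eq_0_successor:
  fixes P :: "real mat"
  assumes P: "P \<in> carrier_mat n n" and "j < n" "k < n" "P $$ (j, k) \<noteq> 0"
    and row: "\<And>l. l < n \<Longrightarrow> (map_mat abs P ^\<^sub>m Suc s) $$ (j, l) = 0" and "l < n"
  shows "(map_mat abs P ^\<^sub>m s) $$ (k, l) = 0"
proof -
  let ?A = "map_mat abs P"
  have A: "?A \<in> carrier_mat n n" using P by simp
  have "(\<Sum>k<n. ?A $$ (j, k) * (?A ^\<^sub>m s) $$ (k, l)) = 0"
    using row[OF \<open>l < n\<close>] pow_mat_Suc_left_entry[OF A \<open>j < n\<close> \<open>l < n\<close>, of s] by metis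
  then have "?A $$ (j, k) * (?A ^\<^sub>m s) $$ (k, l) = 0"
    using assms abs_power_nonneg[OF P _ \<open>l < n\<close>] by (subst (asm) sum_nonneg_eq_0_iff) auto
  then show ?thesis using assms by simp
qed

lemma abs_power_eq_0_iff:
  fixes P :: "real mat"
  assumes P: "P \<in> carrier_mat n n"
  shows "map_mat abs P ^\<^sub>m n = 0\<^sub>m n n \<longleftrightarrow> \<not> (\<exists>J\<subseteq>{..<n}. recurrent_set P J)"
proof -
  let ?A = "map_mat abs P"
  have A: "?A \<in> carrier_mat n n" using P by simp
  have Aent: "?A $$ (j, k) = \<bar>P $$ (j, k)\<bar>" if "j < n" "k < n" for j k
    using that P by simp
  have pos: "0 \<le> (?A ^\<^sub>m s) $$ (j, l)" if "j < n" "l < n" for s j l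
    using abs_power_nonneg[OF P that] .
  have "?A ^\<^sub>m n \<noteq> 0\<^sub>m n n" if J: "J \<subseteq> {..<n}" "recurrent_set P J" for J
  proof -
    have "\<exists>l<n. 0 < (?A ^\<^sub>m s) $$ (j, l)" if "j \<in> J" for s j
      using that
    proof (induction s arbitrary: j)
      case 0
      then show ?case using J P by (intro exI[of _ j]) (auto)
    next
      case (Suc s)
      then obtain k where k: "k \<in> J" "P $$ (j, k) \<noteq> 0"
        using J unfolding recurrent_set_def by blast
      then obtain l where l: "l < n" "0 < (?A ^\<^sub>m s) $$ (k, l)"
        using Suc.IH by blast
      have jk: "j < n" "k < n" using J k Suc.prems by auto
      have "0 < ?A $$ (j, k) * (?A ^\<^sub>m s) $$ (k, l)"
        using l k jk by (simp add: Aent del: index_map_mat)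
      also have "\<dots> \<le> (\<Sum>k<n. ?A $$ (j, k) * (?A ^\<^sub>m s) $$ (k, l))"
        using jk l pos by (intro member_le_sum) (auto simp: Aent simp del: index_map_mat)
      finally show ?case
        using l(1) pow_mat_Suc_left_entry[OF A jk(1) l(1), of s] by metis
    qed
    moreover obtain j where "j \<in> J" using J by (auto simp: recurrent_set_def)
    ultimately obtain l where "l < n" "0 < (?A ^\<^sub>m n) $$ (j, l)" by blast
    moreover have "j < n" using \<open>j \<in> J\<close> J by auto
    ultimately show ?thesis by force
  qed
  moreover have "\<exists>J\<subseteq>{..<n}. recurrent_set P J" if nz: "?A ^\<^sub>m n \<noteq> 0\<^sub>m n n"
  proof -
    have walk: "\<exists>i. i \<in> {1..s + 1} \<rightarrow> {..<n} \<and> i 1 = j \<and> (\<forall>k\<in>{1..s}. P $$ (i k, i (k + 1)) \<noteq> 0)"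
      if "j < n" "l < n" "(?A ^\<^sub>m s) $$ (j, l) \<noteq> 0" for s j l
      using that
    proof (induction s arbitrary: j)
      case 0
      then show ?case by (intro exI[of _ "\<lambda>_. j"]) auto
    next
      case (Suc s)
      obtain k where k: "k < n" "?A $$ (j, k) * (?A ^\<^sub>m s) $$ (k, l) \<noteq> 0"
        using Suc.prems sum.not_neutral_contains_not_neutral
        unfolding pow_mat_Suc_left_entry[OF A Suc.prems(1,2)] by blast
      then have Pjk: "P $$ (j, k) \<noteq> 0" using Suc.prems P by auto
      obtain i where i: "i \<in> {1..s + 1} \<rightarrow> {..<n}" "i 1 = k"
        "\<forall>k\<in>{1..s}. P $$ (i k, i (k + 1)) \<noteq> 0"
        using Suc.IH[of k] k Suc.prems by auto
      \<comment> \<open>The walk that starts in \<open>k\<close>, with \<open>j\<close> put in front; positions are counted from 1.\<close>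
      define i' where "i' = (\<lambda>q. if q \<le> 1 then j else i (q - 1))"
      have "i' q < n" if q: "1 \<le> q" "q \<le> s + 2" for q
      proof (cases "q \<le> 1")
        case False
        then have "q - 1 \<in> {1..s + 1}" using q by auto
        then show ?thesis using i(1) False by (auto simp: i'_def)
      qed (use Suc.prems in \<open>simp add: i'_def\<close>)
      moreover have "P $$ (i' q, i' (q + 1)) \<noteq> 0" if "1 \<le> q" "q \<le> s + 1" for q
      proof (cases "q = 1")
        case False
        then have "q - 1 \<in> {1..s}" "q - 1 + 1 = q" using that by auto
        then have "P $$ (i (q - 1), i q) \<noteq> 0" using i(3) by metis
        then show ?thesis using False that by (auto simp: i'_def)
      qed (use i(2) Pjk in \<open>simp add: i'_def\<close>)
      moreover have "i' 1 = j" by (simp add: i'_def)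
      ultimately show ?case
        by (intro exI[of _ i']) auto
    qed
    have "\<exists>j l. j < n \<and> l < n \<and> (?A ^\<^sub>m n) $$ (j, l) \<noteq> 0"
    proof (rule ccontr)
      assume all0: "\<nexists>j l. j < n \<and> l < n \<and> (?A ^\<^sub>m n) $$ (j, l) \<noteq> 0"
      have An: "?A ^\<^sub>m n \<in> carrier_mat n n" using A by simp
      have "?A ^\<^sub>m n = 0\<^sub>m n n"
        by (rule eq_matI) (use all0 carrier_matD[OF An] in auto)
      then show False using nz by contradiction
    qed
    then obtain j l where "j < n" "l < n" "(?A ^\<^sub>m n) $$ (j, l) \<noteq> 0" by blast
    from walk[OF this] obtain i where "i \<in> {1..n + 1} \<rightarrow> {..<n}"
      "\<forall>k\<in>{1..n}. P $$ (i k, i (k + 1)) \<noteq> 0" by blast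
    then show ?thesis
      unfolding recurrent_set_iff_walk by (intro bexI[of _ i]) auto
  qed
  ultimately show ?thesis by blast
qed

section \<open>Transport with vanishing inflow\<close>

text \<open>
  The equation is required in the interior only; by continuity it holds up to the boundary, where
  a maximum may be attained.
\<close>

lemma transport_equation_on_strip:
  assumes u: "C1_strip u ux ut"
    and a: "continuous_on strip a" and b: "continuous_on strip b"
    and eq: "\<And>x t. 0 < x \<Longrightarrow> x < 1 \<Longrightarrow> 0 < t \<Longrightarrow> ut (x, t) + a (x, t) * ux (x, t) + b (x, t) * u (x, t) = 0"
    and p: "p \<in> strip"
  shows "ut p + a p * ux p + b p * u p = 0"
proof -
  let ?S = "{0<..<1} \<times> {0<..} :: (real \<times> real) set"
  have cl: "closure ?S = strip"
    by (simp add: closure_Times strip_def)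
  have "continuous_on strip u"
    using u unfolding C1_strip_def
    by (meson has_derivative_continuous continuous_on_eq_continuous_within)
  then have "continuous_on strip (\<lambda>p. ut p + a p * ux p + b p * u p)"
    using u a b unfolding C1_strip_def by (intro continuous_intros) auto
  then show ?thesis
    using continuous_constant_on_closure[of ?S "\<lambda>p. ut p + a p * ux p + b p * u p" 0 p] eq p cl
    by auto
qed

text \<open>
  A maximum principle. Here \<open>c\<close> is the inflow end of the interval and \<open>\<sigma>\<close> the direction of
  propagation, so that \<open>\<rho>\<close> in the proof is the distance from the inflow end. Consider the compact region
  $t_0 + \rho / a_0 \le s \le t$, which a characteristic followed backwards leaves only
  through the inflow end, because it travels with speed at least \<open>a0\<close>. For large \<open>K\<close> the function
  $v = e^{-K\rho} u$ decreases along characteristics where it is positive. At a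
  positive maximum, a small step backwards would stay in the region and increase \<open>v\<close>.
\<close>

lemma transport_nonpos:
  fixes c \<sigma> :: real
  assumes u: "C1_strip u ux ut"
    and c\<sigma>: "c = 0 \<and> \<sigma> = 1 \<or> c = 1 \<and> \<sigma> = -1"
    and a: "continuous_on strip a" and b: "continuous_on strip b"
    and a0: "0 < a0" and a_ge: "\<And>p. p \<in> strip \<Longrightarrow> a0 \<le> \<sigma> * a p"
    and B: "\<And>p. p \<in> strip \<Longrightarrow> \<bar>b p\<bar> \<le> B"
    and eq: "\<And>x t. 0 < x \<Longrightarrow> x < 1 \<Longrightarrow> 0 < t \<Longrightarrow> ut (x, t) + a (x, t) * ux (x, t) + b (x, t) * u (x, t) = 0"
    and t0: "0 \<le> t0" and inflow: "\<And>t. t0 \<le> t \<Longrightarrow> u (c, t) \<le> 0"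
    and x: "x \<in> {0..1}" and t: "t0 + 1 / a0 \<le> t"
  shows "u (x, t) \<le> 0"
proof -
  define \<rho> where "\<rho> y = \<sigma> * (y - c)" for y
  define \<Omega> where "\<Omega> = {p. 0 \<le> fst p \<and> fst p \<le> 1 \<and> t0 + \<rho> (fst p) / a0 \<le> snd p \<and> snd p \<le> t}"
  \<comment> \<open>Then \<open>K * (\<sigma> * a)\<close> is at least \<open>B + 1\<close>, which outweighs the zero order term.\<close>
  define K where "K = (B + 1) / a0"
  define v where "v p = exp (- K * \<rho> (fst p)) * u p" for p
  have \<rho>01: "y \<in> {0..1} \<longleftrightarrow> \<rho> y \<in> {0..1}" for y
    using c\<sigma> by (auto simp: \<rho>_def)
  have \<rho>0: "y = c" if "\<rho> y = 0" for y
    using that c\<sigma> by (auto simp: \<rho>_def)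
  have sub: "\<Omega> \<subseteq> {0..1} \<times> {0..t}"
  proof
    fix p assume p: "p \<in> \<Omega>"
    then have "0 \<le> \<rho> (fst p) / a0" using a0 \<rho>01[of "fst p"] by (auto simp: \<Omega>_def)
    then show "p \<in> {0..1} \<times> {0..t}" using p t0 by (cases p) (auto simp: \<Omega>_def)
  qed
  then have \<Omega>strip: "\<Omega> \<subseteq> strip" by (auto simp: strip_def)
  have "closed \<Omega>"
    unfolding \<Omega>_def \<rho>_def
    by (intro closed_Collect_conj closed_Collect_le continuous_intros) (use a0 in auto)
  then have "compact \<Omega>"
    using closed_Int_compact[OF \<open>closed \<Omega>\<close> compact_Times[OF compact_Icc[of 0 1] compact_Icc[of 0 t]]] sub
    by (simp add: Int_absorb2)
  have "\<rho> x / a0 \<le> 1 / a0" using x \<rho>01[of x] a0 by (intro divide_right_mono) auto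
  then have "(x, t) \<in> \<Omega>" using x t by (auto simp: \<Omega>_def)
  have "continuous_on strip u"
    using u unfolding C1_strip_def
    by (meson has_derivative_continuous continuous_on_eq_continuous_within)
  then have "continuous_on \<Omega> u" using \<Omega>strip continuous_on_subset by blast
  then have "continuous_on \<Omega> v"
    unfolding v_def \<rho>_def by (intro continuous_intros)
  then obtain p where p: "p \<in> \<Omega>" and max: "\<And>q. q \<in> \<Omega> \<Longrightarrow> v q \<le> v p"
    using continuous_attains_sup[OF \<open>compact \<Omega>\<close>] \<open>(x, t) \<in> \<Omega>\<close> by blast
  have "v p \<le> 0"
  proof (rule ccontr)
    assume "\<not> v p \<le> 0"
    then have up: "0 < u p" by (simp add: v_def mult_le_0_iff not_le)
    obtain y s where ys: "p = (y, s)" by (cases p)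
    have pst: "p \<in> strip" using p \<Omega>strip by blast
    have \<rho>y: "0 < \<rho> y"
    proof (rule ccontr)
      assume "\<not> 0 < \<rho> y"
      then have "\<rho> y = 0" using \<rho>01[of y] p ys by (auto simp: \<Omega>_def)
      then have "y = c" "t0 \<le> s" using \<rho>0 p ys by (auto simp: \<Omega>_def)
      then show False using inflow[of s] up ys by simp
    qed
    define \<alpha> where "\<alpha> = a p"
    have \<sigma>\<alpha>: "a0 \<le> \<sigma> * \<alpha>" using a_ge[OF pst] by (simp add: \<alpha>_def)
    \<comment> \<open>Moving backwards with the constant velocity \<open>\<alpha>\<close>, the inflow end is reached after the time \<open>e0\<close>.\<close>
    define e0 where "e0 = \<rho> y / (\<sigma> * \<alpha>)"
    have e0: "0 < e0" using \<rho>y \<sigma>\<alpha> a0 by (simp add: e0_def)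
    define \<gamma> where "\<gamma> e = (y - e * \<alpha>, s - e)" for e
    have \<gamma>\<Omega>: "\<gamma> e \<in> \<Omega>" if e: "e \<in> {0..e0}" for e
    proof -
      have r: "\<rho> (y - e * \<alpha>) = \<rho> y - e * (\<sigma> * \<alpha>)" by (simp add: \<rho>_def algebra_simps)
      have "e * (\<sigma> * \<alpha>) \<le> \<rho> y" using e \<sigma>\<alpha> a0 by (simp add: e0_def pos_le_divide_eq)
      moreover have "0 \<le> e * (\<sigma> * \<alpha>)" using e \<sigma>\<alpha> a0 by simp
      moreover have "\<rho> y \<le> 1" using \<rho>01[of y] p ys by (auto simp: \<Omega>_def)
      ultimately have "y - e * \<alpha> \<in> {0..1}" using \<rho>01[of "y - e * \<alpha>"] r by auto
      moreover have "t0 + \<rho> (y - e * \<alpha>) / a0 \<le> s - e"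
      proof -
        have "e * a0 \<le> e * (\<sigma> * \<alpha>)" using e \<sigma>\<alpha> by (intro mult_left_mono) auto
        then have "e \<le> e * (\<sigma> * \<alpha>) / a0" using a0 by (simp add: pos_le_divide_eq)
        moreover have "t0 + \<rho> y / a0 \<le> s" using p ys by (auto simp: \<Omega>_def)
        ultimately show ?thesis unfolding r by (simp add: diff_divide_distrib)
      qed
      moreover have "s - e \<le> t" using e p ys by (auto simp: \<Omega>_def)
      ultimately show ?thesis by (auto simp: \<Omega>_def \<gamma>_def)
    qed
    have "(u has_derivative (\<lambda>(h, k). ux p * h + ut p * k)) (at (\<gamma> 0) within strip)"
      using u pst ys by (auto simp: C1_strip_def \<gamma>_def)
    then have du: "(u has_derivative (\<lambda>(h, k). ux p * h + ut p * k)) (at (\<gamma> 0) within \<gamma> ` {0..e0})"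
      by (rule has_derivative_subset) (use \<gamma>\<Omega> \<Omega>strip in auto)
    have "(\<gamma> has_derivative (\<lambda>e. (- e * \<alpha>, - e))) (at 0 within {0..e0})"
      unfolding \<gamma>_def by (auto intro!: derivative_eq_intros)
    from diff_chain_within[OF this du]
    have dut: "((\<lambda>e. u (\<gamma> e)) has_real_derivative - (ux p * \<alpha> + ut p)) (at 0 within {0..e0})"
      unfolding has_field_derivative_def o_def by (rule has_derivative_eq_rhs) (auto simp: algebra_simps)
    have dexp: "((\<lambda>e. exp (- K * \<rho> (fst (\<gamma> e)))) has_real_derivative
        exp (- K * \<rho> y) * (K * (\<sigma> * \<alpha>))) (at 0 within {0..e0})"
      unfolding \<gamma>_def \<rho>_def by (auto intro!: derivative_eq_intros)
    have "((\<lambda>e. v (\<gamma> e)) has_real_derivative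
        exp (- K * \<rho> y) * (K * (\<sigma> * \<alpha>)) * u p + - (ux p * \<alpha> + ut p) * exp (- K * \<rho> y)) (at 0 within {0..e0})"
      using DERIV_mult[OF dexp dut] unfolding v_def by (simp add: \<gamma>_def ys)
    moreover have "exp (- K * \<rho> y) * (K * (\<sigma> * \<alpha>)) * u p + - (ux p * \<alpha> + ut p) * exp (- K * \<rho> y) > 0"
    proof -
      have "- (ux p * \<alpha> + ut p) = b p * u p"
        using transport_equation_on_strip[OF u a b eq pst] by (simp add: \<alpha>_def algebra_simps)
      then have e: "exp (- K * \<rho> y) * (K * (\<sigma> * \<alpha>)) * u p + - (ux p * \<alpha> + ut p) * exp (- K * \<rho> y)
          = exp (- K * \<rho> y) * (u p * (K * (\<sigma> * \<alpha>) + b p))"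
        by (simp add: algebra_simps)
      have "0 \<le> B" using B[OF pst] by linarith
      then have "K * a0 \<le> K * (\<sigma> * \<alpha>)"
        using \<sigma>\<alpha> a0 by (intro mult_left_mono) (auto simp: K_def)
      then have "B + 1 \<le> K * (\<sigma> * \<alpha>)" using a0 by (simp add: K_def)
      then have "0 < K * (\<sigma> * \<alpha>) + b p" using B[OF pst] by linarith
      then show ?thesis unfolding e using up by (intro mult_pos_pos) auto
    qed
    ultimately obtain d where d: "d > 0" "\<And>h. h > 0 \<Longrightarrow> 0 + h \<in> {0..e0} \<Longrightarrow> h < d \<Longrightarrow> v (\<gamma> 0) < v (\<gamma> (0 + h))"
      using has_real_derivative_pos_inc_right by blast
    define h where "h = min e0 (d / 2)"
    have "v (\<gamma> 0) < v (\<gamma> h)" using d(2)[of h] d(1) e0 by (auto simp: h_def)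
    moreover have "v (\<gamma> h) \<le> v p" using \<gamma>\<Omega>[of h] d(1) e0 by (intro max) (auto simp: h_def)
    ultimately show False by (simp add: \<gamma>_def ys)
  qed
  with max[OF \<open>(x, t) \<in> \<Omega>\<close>] have "v (x, t) \<le> 0" by linarith
  then show ?thesis by (simp add: v_def mult_le_0_iff)
qed

lemma C1_strip_uminus:
  assumes "C1_strip u ux ut"
  shows "C1_strip (\<lambda>p. - u p) (\<lambda>p. - ux p) (\<lambda>p. - ut p)"
  unfolding C1_strip_def
proof (intro conjI ballI)
  fix p assume "p \<in> strip"
  then have "((\<lambda>p. - u p) has_derivative (\<lambda>q. - (\<lambda>(h, k). ux p * h + ut p * k) q)) (at p within strip)"
    using assms by (intro has_derivative_minus) (auto simp: C1_strip_def)
  then show "((\<lambda>p. - u p) has_derivative (\<lambda>(h, k). - ux p * h + - ut p * k)) (at p within strip)"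
    by (simp add: case_prod_unfold)
qed (use assms in \<open>auto simp: C1_strip_def intro!: continuous_intros\<close>)

lemma transport_vanishing:
  fixes c \<sigma> :: real
  assumes u: "C1_strip u ux ut"
    and c\<sigma>: "c = 0 \<and> \<sigma> = 1 \<or> c = 1 \<and> \<sigma> = -1"
    and a: "continuous_on strip a" and b: "continuous_on strip b"
    and a0: "0 < a0" and a_ge: "\<And>p. p \<in> strip \<Longrightarrow> a0 \<le> \<sigma> * a p"
    and B: "\<And>p. p \<in> strip \<Longrightarrow> \<bar>b p\<bar> \<le> B"
    and eq: "\<And>x t. 0 < x \<Longrightarrow> x < 1 \<Longrightarrow> 0 < t \<Longrightarrow> ut (x, t) + a (x, t) * ux (x, t) + b (x, t) * u (x, t) = 0"
    and t0: "0 \<le> t0" and inflow: "\<And>t. t0 \<le> t \<Longrightarrow> u (c, t) = 0"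
    and x: "x \<in> {0..1}" and t: "t0 + 1 / a0 \<le> t"
  shows "u (x, t) = 0"
proof (rule antisym)
  show "u (x, t) \<le> 0" by (rule transport_nonpos[OF u c\<sigma> a b a0 a_ge B eq t0 _ x t]) (use inflow in auto)
  have "- ut (y, s) + a (y, s) * - ux (y, s) + b (y, s) * - u (y, s) = 0"
    if "0 < y" "y < 1" "0 < s" for y s
    using eq[OF that] by simp
  note eq' = this
  have "- u (x, t) \<le> 0"
    by (rule transport_nonpos[OF C1_strip_uminus[OF u] c\<sigma> a b a0 a_ge B eq' t0 _ x t])
      (use inflow in auto)
  then show "0 \<le> u (x, t)" by simp
qed

text \<open>
  Induction on the number of steps: component \<open>j\<close> is extinct at time \<open>s / a0\<close> if row \<open>j\<close> of
  the \<open>s\<close>-th power of the absolute matrix vanishes. The successors of such a \<open>j\<close> are extinct one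
  crossing time earlier, and from then on the inflow of component \<open>j\<close> is zero.
\<close>

lemma classical_solution_vanishes:
  assumes P: "P \<in> carrier_mat n n" and mn: "m \<le> n"
    and adm: "\<And>j. j < n \<Longrightarrow> bounded_C1_strip (a j) \<and> bounded_C1_strip (b j)"
    and a0: "0 < a0" and apos: "\<forall>j<m. \<forall>p\<in>strip. a j p \<ge> a0"
    and aneg: "\<forall>j\<in>{m..<n}. \<forall>p\<in>strip. a j p \<le> - a0"
    and nil: "map_mat abs P ^\<^sub>m n = 0\<^sub>m n n"
    and sol: "classical_solution n m P a b \<phi> u"
    and j: "j < n" and x: "x \<in> {0..1}" and t: "t \<ge> n / a0"
  shows "u j (x, t) = 0"
proof -
  have vanish: "u j (x, t) = 0"
    if "\<And>l. l < n \<Longrightarrow> (map_mat abs P ^\<^sub>m s) $$ (j, l) = 0"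
      "j < n" "x \<in> {0..1}" "t \<ge> s / a0" for s j x t
    using that
  proof (induction s arbitrary: j x t)
    case 0
    from 0(1)[OF 0(2)] show ?case using 0(2) P by simp
  next
    case (Suc s)
    have zero: "P $$ (j, k) * u k (y, \<tau>) = 0"
      if k: "k < n" and y: "y \<in> {0..1}" and \<tau>: "\<tau> \<ge> s / a0" for k y \<tau>
    proof (cases "P $$ (j, k) = 0")
      case False
      have "u k (y, \<tau>) = 0"
        by (rule Suc.IH[OF abs_power_row_eq_0_successor[OF P Suc.prems(2) k False Suc.prems(1)] k y \<tau>])
      then show ?thesis by simp
    qed simp
    have "\<exists>ux ut. C1_strip (u j) ux ut \<and> (\<forall>x t. 0 < x \<and> x < 1 \<and> 0 < t \<longrightarrow>
           ut (x, t) + a j (x, t) * ux (x, t) + b j (x, t) * u j (x, t) = 0)"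
      using sol Suc.prems by (auto simp: classical_solution_def)
    then obtain ux ut where u: "C1_strip (u j) ux ut" and
      eq: "\<And>x t. 0 < x \<Longrightarrow> x < 1 \<Longrightarrow> 0 < t \<Longrightarrow>
           ut (x, t) + a j (x, t) * ux (x, t) + b j (x, t) * u j (x, t) = 0" by blast
    have cont: "continuous_on strip f" if "bounded_C1_strip f" for f
      using that unfolding bounded_C1_strip_def C1_strip_def
      by (meson has_derivative_continuous continuous_on_eq_continuous_within)
    have ab: "continuous_on strip (a j)" "continuous_on strip (b j)"
      using cont adm[OF Suc.prems(2)] by auto
    obtain B where B: "\<And>p. p \<in> strip \<Longrightarrow> \<bar>b j p\<bar> \<le> B"
      using adm[OF Suc.prems(2)] by (auto simp: bounded_C1_strip_def bounded_iff)
    have tt: "s / a0 + 1 / a0 \<le> t" "0 \<le> s / a0"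
      using Suc.prems a0 by (auto simp: add_divide_distrib)
    note van = transport_vanishing[OF u _ _ _ a0 _ B eq tt(2) _ Suc.prems(3) tt(1)]
    show ?case
    proof (cases "j < m")
      case True
      have "u j (0, \<tau>) = 0" if \<tau>: "s / a0 \<le> \<tau>" for \<tau>
      proof -
        have "0 \<le> \<tau>" using tt(2) \<tau> by linarith
        then have "u j (0, \<tau>) = (\<Sum>k<m. P $$ (j, k) * u k (1, \<tau>)) + (\<Sum>k=m..<n. P $$ (j, k) * u k (0, \<tau>))"
          using sol True by (auto simp: classical_solution_def)
        also have "\<dots> = 0 + 0"
          by (intro arg_cong2[where f = "(+)"] sum.neutral ballI) (use zero \<tau> mn in auto)
        finally show ?thesis by simp
      qed
      then show ?thesis
        by (intro van[of 0 1]) (use ab apos True in auto)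
    next
      case False
      have "u j (1, \<tau>) = 0" if \<tau>: "s / a0 \<le> \<tau>" for \<tau>
      proof -
        have "0 \<le> \<tau>" using tt(2) \<tau> by linarith
        then have "u j (1, \<tau>) = (\<Sum>k<m. P $$ (j, k) * u k (1, \<tau>)) + (\<Sum>k=m..<n. P $$ (j, k) * u k (0, \<tau>))"
          using sol False Suc.prems by (auto simp: classical_solution_def)
        also have "\<dots> = 0 + 0"
          by (intro arg_cong2[where f = "(+)"] sum.neutral ballI) (use zero \<tau> mn in auto)
        finally show ?thesis by simp
      qed
      then show ?thesis
        by (intro van[of 1 "-1"]) (use ab aneg False Suc.prems(2) in \<open>auto simp: le_minus_iff\<close>)
    qed
  qed
  show ?thesis
  proof (rule vanish[of n])
    show "(map_mat abs P ^\<^sub>m n) $$ (j, l) = 0" if "l < n" for l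
      using nil j that by simp
  qed (use j x t in auto)
qed

section \<open>Density of the test functions\<close>

text \<open>
  For constant \<open>q\<close> this is the standard smooth function that is flat at 0. The polynomial factor in
  \<open>1 / y\<close> makes the family closed under differentiation.
\<close>

definition flat :: "real poly \<Rightarrow> real \<Rightarrow> real" where
  "flat q y = (if y > 0 then poly q (1 / y) * exp (- 1 / y) else 0)"

lemma poly_times_exp_minus_tendsto_0:
  "((\<lambda>z :: real. poly q z * exp (- z)) \<longlongrightarrow> 0) at_top"
proof -
  have "((\<lambda>z. \<Sum>i\<le>degree q. coeff q i * (z ^ i / exp z)) \<longlongrightarrow> (\<Sum>i\<le>degree q. coeff q i * 0)) at_top"
    by (intro tendsto_intros tendsto_power_div_exp_0)
  then show ?thesis
    by (simp add: poly_altdef sum_distrib_right sum_divide_distrib exp_minus field_simps)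
qed

text \<open>
  In terms of \<open>z = 1 / y\<close>, differentiating $q(z)\, e^{-z}$ gives $z^2 (q(z) - q'(z))\, e^{-z}$; the two
  \<open>pCons\<close> are the factor $z^2$. At 0 the exponential beats every polynomial.
\<close>

lemma DERIV_flat:
  "(flat q has_real_derivative flat (pCons 0 (pCons 0 (q - pderiv q))) y) (at y)"
proof -
  consider "y > 0" | "y < 0" | "y = 0" by linarith
  then show ?thesis
  proof cases
    case 1
    have "((\<lambda>y. poly q (1 / y) * exp (- 1 / y)) has_real_derivative
        flat (pCons 0 (pCons 0 (q - pderiv q))) y) (at y)"
      using 1 by (auto intro!: derivative_eq_intros simp: flat_def field_simps power2_eq_square)
    then show ?thesis
      by (rule has_field_derivative_transform_within_open[of _ _ _ "{0<..}"]) (use 1 in \<open>auto simp: flat_def\<close>)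
  next
    case 2
    have "((\<lambda>y. 0) has_real_derivative flat (pCons 0 (pCons 0 (q - pderiv q))) y) (at y)"
      using 2 by (simp add: flat_def)
    then show ?thesis
      by (rule has_field_derivative_transform_within_open[of _ _ _ "{..<0}"]) (use 2 in \<open>auto simp: flat_def\<close>)
  next
    case 3
    have "((\<lambda>h. flat q h / h) \<longlongrightarrow> 0) (at 0)"
    proof (rule filterlim_split_at)
      show "((\<lambda>h. flat q h / h) \<longlongrightarrow> 0) (at_left 0)"
        by (rule Lim_transform_eventually[of "\<lambda>_. 0"])
          (auto simp: eventually_at_left_field flat_def intro: exI[of _ "-1"])
      have "((\<lambda>z. flat q (inverse z) / inverse z) \<longlongrightarrow> 0) at_top"
        using poly_times_exp_minus_tendsto_0[of "pCons 0 q"]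
        by (rule Lim_transform_eventually)
          (auto simp: flat_def field_simps intro: eventually_mono[OF eventually_gt_at_top[of 0]])
      then show "((\<lambda>h. flat q h / h) \<longlongrightarrow> 0) (at_right 0)"
        by (simp add: filterlim_at_right_to_top)
    qed
    then show ?thesis
      using 3 by (simp add: has_field_derivative_iff flat_def)
  qed
qed

text \<open>
  An algebra of functions that contains the polynomials and the cutoff functions and is closed under
  differentiation. This closure gives derivatives of all orders without a Leibniz formula.
\<close>

inductive smooth_elem :: "(real \<Rightarrow> real) \<Rightarrow> bool" where
  const: "smooth_elem (\<lambda>_. c)"
| ident: "smooth_elem (\<lambda>x. x)"
| flat: "smooth_elem (\<lambda>x. flat q (\<alpha> * x + \<beta>))"
| add: "smooth_elem f \<Longrightarrow> smooth_elem g \<Longrightarrow> smooth_elem (\<lambda>x. f x + g x)"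
| mult: "smooth_elem f \<Longrightarrow> smooth_elem g \<Longrightarrow> smooth_elem (\<lambda>x. f x * g x)"

lemma smooth_elem_deriv:
  assumes "smooth_elem f"
  shows "\<exists>f'. smooth_elem f' \<and> (\<forall>x. (f has_real_derivative f' x) (at x))"
  using assms
proof induction
  case (const c)
  show ?case by (rule exI[of _ "\<lambda>_. 0"]) (auto intro: smooth_elem.intros)
next
  case ident
  show ?case by (rule exI[of _ "\<lambda>_. 1"]) (auto intro: smooth_elem.intros)
next
  case (flat q \<alpha> \<beta>)
  let ?q = "pCons 0 (pCons 0 (q - pderiv q))"
  have "((\<lambda>x. flat q (\<alpha> * x + \<beta>)) has_real_derivative flat ?q (\<alpha> * x + \<beta>) * \<alpha>) (at x)" for x
    by (rule DERIV_chain2[OF DERIV_flat]) (auto intro!: derivative_eq_intros)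
  then show ?case
    by (intro exI[of _ "\<lambda>x. flat ?q (\<alpha> * x + \<beta>) * \<alpha>"]) (auto intro: smooth_elem.intros)
next
  case (add f g)
  then obtain f' g' where "smooth_elem f'" "\<forall>x. (f has_real_derivative f' x) (at x)"
    "smooth_elem g'" "\<forall>x. (g has_real_derivative g' x) (at x)" by blast
  then show ?case
    by (intro exI[of _ "\<lambda>x. f' x + g' x"]) (auto intro: smooth_elem.intros DERIV_add)
next
  case (mult f g)
  then obtain f' g' where "smooth_elem f'" "\<forall>x. (f has_real_derivative f' x) (at x)"
    "smooth_elem g'" "\<forall>x. (g has_real_derivative g' x) (at x)" by blast
  then show ?case
    using mult.hyps
    by (intro exI[of _ "\<lambda>x. f' x * g x + g' x * f x"]) (auto intro!: smooth_elem.intros DERIV_mult)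
qed

lemma smooth_elem_derivatives:
  assumes "smooth_elem f"
  obtains D where "D 0 = f" "\<And>k x. (D k has_real_derivative D (Suc k) x) (at x)"
proof -
  obtain d where d: "\<And>f. smooth_elem f \<Longrightarrow> smooth_elem (d f) \<and> (\<forall>x. (f has_real_derivative d f x) (at x))"
    using smooth_elem_deriv by metis
  have "smooth_elem ((d ^^ k) f)" for k
    by (induction k) (use d assms in auto)
  then show thesis
    using that[of "\<lambda>k. (d ^^ k) f"] d by simp
qed

lemma smooth_elem_polynomial:
  assumes "real_polynomial_function p"
  shows "smooth_elem p"
  using assms
proof induction
  case (linear f)
  then have "f = (\<lambda>x. f 1 * x)"
    using linear_simps(5)[of f _ 1] by (metis (no_types) mult.commute mult.right_neutral real_scaleR_def ext)
  moreover have "smooth_elem (\<lambda>x. f 1 * x)" by (intro smooth_elem.intros)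
  ultimately show ?case by simp
qed (auto intro: smooth_elem.intros)

text \<open>
  Supported in \<open>{1 / r..1 - 1 / r}\<close>; the values tend to 1 on the open interval as \<open>r\<close> grows.
\<close>

definition cutoff :: "real \<Rightarrow> real \<Rightarrow> real" where
  "cutoff r x = flat 1 (r * x - 1) * flat 1 (r * (1 - x) - 1)"

lemma flat_1_bounds: "0 \<le> flat 1 y" "flat 1 y \<le> 1"
  by (auto simp: flat_def)

lemma cutoff_bounds: "0 \<le> cutoff r x" "cutoff r x \<le> 1"
  unfolding cutoff_def using flat_1_bounds by (auto intro: mult_le_one)

lemma smooth_elem_cutoff: "smooth_elem (cutoff r)"
proof -
  have "smooth_elem (\<lambda>x. flat 1 (r * x + (-1)) * flat 1 ((-r) * x + (r - 1)))"
    by (intro smooth_elem.intros)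
  then show ?thesis
    by (simp add: cutoff_def[abs_def] algebra_simps)
qed

lemma C0_infinity_cutoff:
  assumes "smooth_elem g" "0 < r"
  shows "C0_infinity (\<lambda>x. g x * cutoff r x)"
proof -
  have "smooth_elem (\<lambda>x. g x * cutoff r x)"
    by (intro smooth_elem.intros assms smooth_elem_cutoff)
  then obtain D where D: "D 0 = (\<lambda>x. g x * cutoff r x)" "\<And>k x. (D k has_real_derivative D (Suc k) x) (at x)"
    using smooth_elem_derivatives by blast
  have "{x\<in>{0..1}. g x * cutoff r x \<noteq> 0} \<subseteq> {1 / r..1 - 1 / r}"
    using assms by (auto simp: cutoff_def flat_def field_simps split: if_splits)
  then have "closure {x\<in>{0..1}. g x * cutoff r x \<noteq> 0} \<subseteq> {1 / r..1 - 1 / r}"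
    by (rule closure_minimal) auto
  also have "\<dots> \<subseteq> {0<..<1}"
  proof -
    have "0 < 1 / r" using assms by simp
    then show ?thesis
      by (intro subsetI) (simp only: atLeastAtMost_iff greaterThanLessThan_iff, linarith)
  qed
  finally show ?thesis
    unfolding C0_infinity_def
    by (intro conjI exI[of _ D] allI ballI has_field_derivative_at_within[OF D(2)]) (simp_all add: D(1))
qed

lemma cutoff_tendsto_1:
  assumes "0 < x" "x < 1"
  shows "(\<lambda>l. cutoff (real (Suc l)) x) \<longlonglongrightarrow> 1"
proof -
  have "(\<lambda>l. flat 1 (real (Suc l) * y - 1)) \<longlonglongrightarrow> 1" if "0 < y" for y
  proof -
    have "filterlim (\<lambda>l. real (Suc l)) at_top sequentially"
      by (rule filterlim_compose[OF filterlim_real_sequentially filterlim_Suc])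
    then have "filterlim (\<lambda>l. y * real (Suc l)) at_top sequentially"
      by (rule filterlim_tendsto_pos_mult_at_top[OF tendsto_const that])
    from filterlim_tendsto_add_at_top[OF tendsto_const[of "-1"] this]
    have inf: "filterlim (\<lambda>l. real (Suc l) * y - 1) at_top sequentially"
      by (simp add: algebra_simps)
    have "(\<lambda>l. - 1 / (real (Suc l) * y - 1)) \<longlonglongrightarrow> 0"
      by (rule real_tendsto_divide_at_top[OF tendsto_const inf])
    then have "(\<lambda>l. exp (- 1 / (real (Suc l) * y - 1))) \<longlonglongrightarrow> exp 0"
      by (rule tendsto_exp)
    then have lim: "(\<lambda>l. exp (- 1 / (real (Suc l) * y - 1))) \<longlonglongrightarrow> 1" by simp
    have "\<forall>\<^sub>F l in sequentially. real (Suc l) * y - 1 > 0"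
      using inf by (simp only: filterlim_at_top_dense)
    then have "\<forall>\<^sub>F l in sequentially. exp (- 1 / (real (Suc l) * y - 1)) = flat 1 (real (Suc l) * y - 1)"
      by eventually_elim (simp add: flat_def)
    then show ?thesis by (rule Lim_transform_eventually[OF lim])
  qed
  from tendsto_mult[OF this[of x] this[of "1 - x"]] show ?thesis
    unfolding cutoff_def using assms by simp
qed

abbreviation I01 :: "real measure" where "I01 \<equiv> lebesgue_on {0<..<1}"

text \<open>
  A measurable function is almost everywhere a limit of continuous ones. These are truncated at the
  level \<open>K\<close>, replaced by polynomials uniformly on the closed interval and multiplied by cutoff
  functions. The common bound makes dominated convergence available.
\<close>

lemma C0_infinity_approximates_bounded:
  fixes f :: "real \<Rightarrow> real"
  assumes f: "f \<in> borel_measurable I01" and K: "0 \<le> K" "\<And>x. \<bar>f x\<bar> \<le> K"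
  shows "\<exists>\<phi>. (\<forall>l. C0_infinity (\<phi> l)) \<and> (\<forall>l. \<phi> l \<in> borel_measurable I01) \<and>
    (\<forall>l x. x \<in> {0<..<1} \<longrightarrow> \<bar>\<phi> l x\<bar> \<le> K + 1) \<and>
    (AE x in I01. (\<lambda>l. \<phi> l x) \<longlonglongrightarrow> f x)"
proof -
  have "f measurable_on {0<..<1}"
    using f by (subst measurable_on_iff_borel_measurable) auto
  then obtain N g where N: "negligible N" and g: "\<And>l. continuous_on UNIV (g l)"
    and lim: "\<And>x. x \<notin> N \<Longrightarrow> (\<lambda>l. g l x) \<longlonglongrightarrow> (if x \<in> {0<..<1} then f x else 0)"
    unfolding measurable_on_def by metis
  define h where "h l x = max (- K) (min K (g l x))" for l x
  have "\<exists>p. real_polynomial_function p \<and> (\<forall>x\<in>{0..1}. \<bar>h l x - p x\<bar> < 1 / real (Suc l))" for l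
  proof -
    have "continuous_on {0..1} (h l)"
      unfolding h_def by (intro continuous_intros continuous_on_subset[OF g]) auto
    from Stone_Weierstrass_real_polynomial_function[OF compact_Icc this, of "1 / real (Suc l)"]
    show ?thesis by (metis of_nat_0_less_iff zero_less_Suc zero_less_divide_1_iff)
  qed
  then obtain p where p: "\<And>l. real_polynomial_function (p l)"
    and hp: "\<And>l x. x \<in> {0..1} \<Longrightarrow> \<bar>h l x - p l x\<bar> < 1 / real (Suc l)" by metis
  define \<phi> where "\<phi> l x = p l x * cutoff (real (Suc l)) x" for l x
  have C0: "C0_infinity (\<phi> l)" for l
    unfolding \<phi>_def by (intro C0_infinity_cutoff smooth_elem_polynomial p) auto
  have meas: "\<phi> l \<in> borel_measurable I01" for l
  proof (rule continuous_imp_measurable_on_sets_lebesgue)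
    have "smooth_elem (\<phi> l)"
      unfolding \<phi>_def by (intro smooth_elem.intros smooth_elem_polynomial p smooth_elem_cutoff)
    then show "continuous_on {0<..<1} (\<phi> l)"
      by (metis smooth_elem_deriv DERIV_continuous_on has_field_derivative_at_within)
  qed auto
  have bound: "\<bar>\<phi> l x\<bar> \<le> K + 1" if "x \<in> {0<..<1}" for l x
  proof -
    have "\<bar>h l x - p l x\<bar> < 1 / real (Suc l)" using hp[of x l] that by auto
    also have "\<dots> \<le> 1" by simp
    finally have "\<bar>p l x\<bar> \<le> K + 1" using K(1) by (auto simp: h_def)
    then have "\<bar>p l x\<bar> * \<bar>cutoff (real (Suc l)) x\<bar> \<le> (K + 1) * 1"
      using cutoff_bounds[of "real (Suc l)" x] K(1) by (intro mult_mono) auto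
    then show ?thesis by (simp add: \<phi>_def abs_mult)
  qed
  have conv: "(\<lambda>l. \<phi> l x) \<longlonglongrightarrow> f x" if x: "x \<in> {0<..<1}" "x \<notin> N" for x
  proof -
    have "(\<lambda>l. g l x) \<longlonglongrightarrow> f x" using lim[of x] x by simp
    then have "(\<lambda>l. h l x) \<longlonglongrightarrow> max (- K) (min K (f x))"
      unfolding h_def by (intro tendsto_intros)
    moreover have "max (- K) (min K (f x)) = f x" using K(2)[of x] by auto
    ultimately have h: "(\<lambda>l. h l x) \<longlonglongrightarrow> f x" by simp
    have "(\<lambda>l. h l x - p l x) \<longlonglongrightarrow> 0"
    proof (rule Lim_null_comparison)
      show "\<forall>\<^sub>F l in sequentially. norm (h l x - p l x) \<le> 1 / real (Suc l)"
        using hp[of x] x by (intro always_eventually) (auto intro: less_imp_le)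
      show "(\<lambda>l. 1 / real (Suc l)) \<longlonglongrightarrow> 0" by (rule lim_1_over_n[THEN LIMSEQ_Suc])
    qed
    from tendsto_diff[OF h this] have "(\<lambda>l. p l x) \<longlonglongrightarrow> f x" by simp
    from tendsto_mult[OF this cutoff_tendsto_1[of x]] show ?thesis
      using x by (simp add: \<phi>_def)
  qed
  have "N \<in> null_sets lebesgue" using N by (simp add: negligible_iff_null_sets)
  then have "AE x in lebesgue. x \<notin> N" by (rule AE_not_in)
  then have "AE x in I01. (\<lambda>l. \<phi> l x) \<longlonglongrightarrow> f x"
    using conv by (subst AE_restrict_space_iff) auto
  then show ?thesis using C0 meas bound by blast
qed

lemma finite_measure_I01: "finite_measure I01"
  by (rule finite_measureI) (simp add: emeasure_restrict_space space_restrict_space)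

text \<open>
  Truncation reduces to bounded functions: the truncations of \<open>f\<close> differ from \<open>f\<close> by at most
  \<open>\<bar>f\<bar>\<close>, so they converge to \<open>f\<close> in $L^2$ by dominated convergence.
\<close>

lemma C0_infinity_dense:
  assumes f: "L2_fun f" and \<epsilon>: "0 < \<epsilon>"
  shows "\<exists>\<phi>. C0_infinity \<phi> \<and> (\<integral>x. (\<phi> x - f x)\<^sup>2 \<partial>I01) < \<epsilon>"
proof -
  interpret finite_measure I01 by (rule finite_measure_I01)
  have fm[measurable]: "f \<in> borel_measurable I01" and fi: "integrable I01 (\<lambda>x. (f x)\<^sup>2)"
    using f by (auto simp: L2_fun_def)
  define T where "T K x = max (- real K) (min (real K) (f x))" for K x
  have T_meas[measurable]: "T K \<in> borel_measurable I01" for K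
    unfolding T_def by measurable
  have T_le: "(T K x - f x)\<^sup>2 \<le> (f x)\<^sup>2" for K x
    by (rule power2_le_iff_abs_le[THEN iffD2, of "\<bar>_\<bar>", simplified]) (auto simp: T_def)
  have "(\<lambda>K. \<integral>x. (T K x - f x)\<^sup>2 \<partial>I01) \<longlonglongrightarrow> (\<integral>x. 0 \<partial>I01)"
  proof (rule integral_dominated_convergence[OF _ _ fi])
    show "AE x in I01. (\<lambda>K. (T K x - f x)\<^sup>2) \<longlonglongrightarrow> 0"
    proof (rule AE_I2)
      fix x
      obtain K0 :: nat where K0: "\<bar>f x\<bar> \<le> real K0" using real_arch_simple by blast
      have "\<forall>\<^sub>F K in sequentially. 0 = (T K x - f x)\<^sup>2"
        using eventually_ge_at_top[of K0] by eventually_elim (use K0 in \<open>auto simp: T_def\<close>)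
      then show "(\<lambda>K. (T K x - f x)\<^sup>2) \<longlonglongrightarrow> 0" by (rule Lim_transform_eventually[OF tendsto_const])
    qed
  qed (use T_le in \<open>auto intro: AE_I2\<close>)
  then have "\<forall>\<^sub>F K in sequentially. (\<integral>x. (T K x - f x)\<^sup>2 \<partial>I01) < \<epsilon> / 4"
    using \<epsilon> by (intro order_tendstoD(2)) auto
  then obtain K where K: "(\<integral>x. (T K x - f x)\<^sup>2 \<partial>I01) < \<epsilon> / 4"
    by (auto simp: eventually_sequentially)
  have TK: "\<bar>T K x\<bar> \<le> real K" for x by (auto simp: T_def)
  obtain \<phi> where \<phi>: "\<And>l. C0_infinity (\<phi> l)" and \<phi>m[measurable]: "\<And>l. \<phi> l \<in> borel_measurable I01"
    and \<phi>b: "\<And>l x. x \<in> {0<..<1} \<Longrightarrow> \<bar>\<phi> l x\<bar> \<le> real K + 1"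
    and \<phi>T: "AE x in I01. (\<lambda>l. \<phi> l x) \<longlonglongrightarrow> T K x"
    using C0_infinity_approximates_bounded[OF T_meas, of "real K", OF _ TK] by auto
  have sq: "(\<phi> l x - T K x)\<^sup>2 \<le> (2 * real K + 1)\<^sup>2" if "x \<in> {0<..<1}" for l x
    using \<phi>b[OF that, of l] TK[of x] by (intro power2_le_iff_abs_le[THEN iffD2]) auto
  have bd: "AE x in I01. norm ((\<phi> l x - T K x)\<^sup>2) \<le> (2 * real K + 1)\<^sup>2" for l
    by (rule AE_I2) (use sq in \<open>auto simp: space_restrict_space\<close>)
  have "(\<lambda>l. \<integral>x. (\<phi> l x - T K x)\<^sup>2 \<partial>I01) \<longlonglongrightarrow> (\<integral>x. 0 \<partial>I01)"
  proof (rule integral_dominated_convergence[OF _ _ _ _ bd])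
    show "AE x in I01. (\<lambda>l. (\<phi> l x - T K x)\<^sup>2) \<longlonglongrightarrow> 0"
      using \<phi>T
    proof eventually_elim
      case (elim x)
      then have "(\<lambda>l. (\<phi> l x - T K x)\<^sup>2) \<longlonglongrightarrow> (T K x - T K x)\<^sup>2"
        by (intro tendsto_intros)
      then show ?case by simp
    qed
  qed auto
  then have "\<forall>\<^sub>F l in sequentially. (\<integral>x. (\<phi> l x - T K x)\<^sup>2 \<partial>I01) < \<epsilon> / 4"
    using \<epsilon> by (intro order_tendstoD(2)) auto
  then obtain l where l: "(\<integral>x. (\<phi> l x - T K x)\<^sup>2 \<partial>I01) < \<epsilon> / 4"
    by (auto simp: eventually_sequentially)
  have i1: "integrable I01 (\<lambda>x. (\<phi> l x - T K x)\<^sup>2)"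
    by (rule integrable_const_bound[OF bd]) measurable
  have i2: "integrable I01 (\<lambda>x. (T K x - f x)\<^sup>2)"
    by (rule Bochner_Integration.integrable_bound[OF fi]) (use T_le in \<open>auto intro: AE_I2\<close>)
  have "(\<integral>x. (\<phi> l x - f x)\<^sup>2 \<partial>I01) \<le> (\<integral>x. 2 * (\<phi> l x - T K x)\<^sup>2 + 2 * (T K x - f x)\<^sup>2 \<partial>I01)"
  proof (rule Bochner_Integration.integral_mono')
    show "(\<phi> l x - f x)\<^sup>2 \<le> 2 * (\<phi> l x - T K x)\<^sup>2 + 2 * (T K x - f x)\<^sup>2" for x
      using sum_squares_ge_zero[of "(\<phi> l x - T K x) - (T K x - f x)" 0]
      by (simp add: power2_eq_square algebra_simps)
  qed (use i1 i2 in auto)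
  also have "\<dots> = 2 * (\<integral>x. (\<phi> l x - T K x)\<^sup>2 \<partial>I01) + 2 * (\<integral>x. (T K x - f x)\<^sup>2 \<partial>I01)"
    using i1 i2 by simp
  also have "\<dots> < \<epsilon>" using l K by simp
  finally show ?thesis using \<phi> by blast
qed

lemma C0_infinity_dense_sequence:
  assumes "0 < n" and f: "\<And>j. j < n \<Longrightarrow> L2_fun (f j)"
  shows "\<exists>\<phi>l. (\<forall>l. \<forall>j<n. C0_infinity (\<phi>l l j)) \<and> (\<lambda>l. L2_norm_n n (\<lambda>j x. \<phi>l l j x - f j x)) \<longlonglongrightarrow> 0"
proof -
  have "\<exists>\<phi>. C0_infinity \<phi> \<and> L2_norm (\<lambda>x. \<phi> x - f j x) < 1 / real (Suc l)" if j: "j < n" for l j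
  proof -
    have "0 < (1 / real (Suc l))\<^sup>2" by (rule zero_less_power) simp
    from C0_infinity_dense[OF f[OF j] this]
    obtain \<phi> where \<phi>: "C0_infinity \<phi>" "(\<integral>x. (\<phi> x - f j x)\<^sup>2 \<partial>I01) < (1 / real (Suc l))\<^sup>2"
      by blast
    then have "L2_norm (\<lambda>x. \<phi> x - f j x) < sqrt ((1 / real (Suc l))\<^sup>2)"
      unfolding L2_norm_def by (intro real_sqrt_less_mono)
    also have "sqrt ((1 / real (Suc l))\<^sup>2) = 1 / real (Suc l)"
      by (subst real_sqrt_abs) simp
    finally show ?thesis using \<phi>(1) by blast
  qed
  note ex = this
  define \<phi>l where "\<phi>l l j = (SOME \<phi>. C0_infinity \<phi> \<and> L2_norm (\<lambda>x. \<phi> x - f j x) < 1 / real (Suc l))" for l j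
  have \<phi>l: "C0_infinity (\<phi>l l j)" "L2_norm (\<lambda>x. \<phi>l l j x - f j x) < 1 / real (Suc l)" if "j < n" for l j
    using someI_ex[OF ex[OF that, of l]] by (simp_all only: \<phi>l_def)
  have "(\<lambda>l. L2_norm_n n (\<lambda>j x. \<phi>l l j x - f j x)) \<longlonglongrightarrow> 0"
  proof (rule tendsto_sandwich[of "\<lambda>_. 0" _ _ "\<lambda>l. 1 / real (Suc l)"])
    have "0 \<le> L2_norm_n n (\<lambda>j x. \<phi>l l j x - f j x)" for l
    proof -
      have "0 \<le> L2_norm (\<lambda>x. \<phi>l l 0 x - f 0 x)" by (simp add: L2_norm_def)
      also have "\<dots> \<le> L2_norm_n n (\<lambda>j x. \<phi>l l j x - f j x)"
        unfolding L2_norm_n_def using \<open>0 < n\<close> by (intro Max_ge) auto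
      finally show ?thesis .
    qed
    then show "\<forall>\<^sub>F l in sequentially. 0 \<le> L2_norm_n n (\<lambda>j x. \<phi>l l j x - f j x)" by simp
    have "L2_norm_n n (\<lambda>j x. \<phi>l l j x - f j x) \<le> 1 / real (Suc l)" for l
      unfolding L2_norm_n_def using \<open>0 < n\<close> \<phi>l(2)[of _ l] by (intro Max.boundedI) (auto intro: less_imp_le)
    then show "\<forall>\<^sub>F l in sequentially. L2_norm_n n (\<lambda>j x. \<phi>l l j x - f j x) \<le> 1 / real (Suc l)" by simp
    show "(\<lambda>l. 1 / real (Suc l)) \<longlonglongrightarrow> 0" by (rule lim_1_over_n[THEN LIMSEQ_Suc])
  qed auto
  then show ?thesis using \<phi>l(1) by blast
qed

section \<open>Extinction in the acyclic case\<close>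

lemma L2_norm_nonneg: "0 \<le> L2_norm f"
  by (simp add: L2_norm_def)

lemma L2_norm_power2: "(L2_norm f)\<^sup>2 = (\<integral>x. (f x)\<^sup>2 \<partial>I01)"
  by (simp add: L2_norm_def)

lemma L2_norm_cong: "(\<And>x. x \<in> {0<..<1} \<Longrightarrow> f x = g x) \<Longrightarrow> L2_norm f = L2_norm g"
  unfolding L2_norm_def by (intro arg_cong[where f = sqrt] Bochner_Integration.integral_cong) (auto simp: space_restrict_space)

lemma L2_norm_le_n: "j < n \<Longrightarrow> L2_norm (f j) \<le> L2_norm_n n f"
  unfolding L2_norm_n_def by (intro Max_ge) auto

lemma L2_norm_n_leI: "0 < n \<Longrightarrow> (\<And>j. j < n \<Longrightarrow> L2_norm (f j) \<le> c) \<Longrightarrow> L2_norm_n n f \<le> c"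
  unfolding L2_norm_n_def by (intro Max.boundedI) auto

text \<open>
  After the time \<open>n / a0\<close>, which does not depend on the data, all approximating classical solutions
  are extinct, and so is their limit.
\<close>

lemma robust_FTS_of_nilpotent:
  assumes P: "P \<in> carrier_mat n n" and mn: "m \<le> n" and n: "0 < n"
    and nil: "map_mat abs P ^\<^sub>m n = 0\<^sub>m n n"
  shows "robust_finite_time_stabilizable n m P"
  unfolding robust_finite_time_stabilizable_def
proof (intro allI impI)
  fix a b assume "admissible n m a b"
  then obtain a0 where a0: "0 < a0" "\<forall>j<m. \<forall>p\<in>strip. a j p \<ge> a0" "\<forall>j\<in>{m..<n}. \<forall>p\<in>strip. a j p \<le> - a0"
    and ab: "\<And>j. j < n \<Longrightarrow> bounded_C1_strip (a j) \<and> bounded_C1_strip (b j)"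
    unfolding admissible_def by blast
  show "finite_time_stabilizable n m P a b"
    unfolding finite_time_stabilizable_def
  proof (intro exI[of _ "n / a0"] conjI allI impI)
    show "0 < n / a0" using n a0 by simp
    fix \<phi> u t j
    assume \<phi>: "\<forall>j<n. L2_fun (\<phi> j)" and gen: "L2_generalized_solution n m P a b \<phi> u"
      and t: "n / a0 < t" and j: "j < n"
    obtain \<phi>l where \<phi>l: "\<forall>l. \<forall>j<n. C0_infinity (\<phi>l l j)"
      "(\<lambda>l. L2_norm_n n (\<lambda>j x. \<phi>l l j x - \<phi> j x)) \<longlonglongrightarrow> 0"
      using C0_infinity_dense_sequence[OF n] \<phi> by blast
    then obtain ul where ul: "\<And>l. classical_solution n m P a b (\<phi>l l) (ul l)"
      and lim: "\<And>T. T > 0 \<Longrightarrow> uniform_limit {0..T}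
         (\<lambda>l t. L2_norm_n n (\<lambda>j x. u j (x, t) - ul l j (x, t))) (\<lambda>t. 0) sequentially"
      using gen unfolding L2_generalized_solution_def by blast
    have t0: "0 < t" using t n a0 by (smt (verit) divide_pos_pos of_nat_0_less_iff)
    have "(\<lambda>l. L2_norm_n n (\<lambda>j x. u j (x, t) - ul l j (x, t))) \<longlonglongrightarrow> 0"
      by (rule tendsto_uniform_limitI[OF lim[OF t0]]) (use t0 in auto)
    moreover have "L2_norm_n n (\<lambda>j x. u j (x, t) - ul l j (x, t)) = L2_norm_n n (\<lambda>j x. u j (x, t))" for l
    proof -
      have "ul l i (x, t) = 0" if "i < n" "x \<in> {0<..<1}" for i x
        by (rule classical_solution_vanishes[OF P mn ab a0 nil ul that(1)]) (use that t in auto)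
      then have "L2_norm (\<lambda>x. u i (x, t) - ul l i (x, t)) = L2_norm (\<lambda>x. u i (x, t))" if "i < n" for i
        using that by (intro L2_norm_cong) auto
      then show ?thesis unfolding L2_norm_n_def by simp
    qed
    ultimately have "(\<lambda>l. L2_norm_n n (\<lambda>j x. u j (x, t))) \<longlonglongrightarrow> 0" by simp
    from LIMSEQ_unique[OF tendsto_const this] have "L2_norm (\<lambda>x. u j (x, t)) = 0"
      using L2_norm_le_n[OF j, of "\<lambda>j x. u j (x, t)"] L2_norm_nonneg[of "\<lambda>x. u j (x, t)"] by linarith
    then have "(\<integral>x. (u j (x, t))\<^sup>2 \<partial>I01) = 0" using L2_norm_power2[of "\<lambda>x. u j (x, t)"] by simp
    moreover have "integrable I01 (\<lambda>x. (u j (x, t))\<^sup>2)"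
      using gen j t0 unfolding L2_generalized_solution_def continuous_L2_def L2_fun_def by auto
    ultimately have "AE x in I01. (u j (x, t))\<^sup>2 = 0"
      by (subst (asm) integral_nonneg_eq_0_iff_AE) auto
    then show "AE x in I01. u j (x, t) = 0" by simp
  qed
qed

section \<open>Explicit solutions for unit speeds and constant damping\<close>

text \<open>
  A test function lives on the closed interval only; extended by 0 it is still $C^1$, because it
  vanishes near both ends.
\<close>

lemma C0_infinity_extension:
  assumes "C0_infinity f"
  obtains W W' where "\<And>x. (W has_real_derivative W' x) (at x)" "continuous_on UNIV W'"
    "\<And>x. x \<in> {0..1} \<Longrightarrow> W x = f x" "\<And>x. x \<notin> {0<..<1} \<Longrightarrow> W x = 0" "\<And>x. x \<notin> {0<..<1} \<Longrightarrow> W' x = 0"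
proof -
  obtain D where D0: "\<And>x. x \<in> {0..1} \<Longrightarrow> D 0 x = f x"
    and D: "\<And>k x. x \<in> {0..1} \<Longrightarrow> (D k has_real_derivative D (Suc k) x) (at x within {0..1})"
    and cl: "closure {x\<in>{0..1}. f x \<noteq> 0} \<subseteq> {0<..<1}"
    using assms unfolding C0_infinity_def by blast
  define S where "S = closure {x\<in>{0..1}. f x \<noteq> 0}"
  define W where "W x = (if x \<in> {0..1} then f x else 0)" for x
  define W' where "W' x = (if x \<in> {0<..<1} then D 1 x else 0)" for x
  have S: "S \<subseteq> {0<..<1}" "open (- S)" using cl by (auto simp: S_def)
  have W0: "W x = 0" if "x \<notin> S" for x
    using that closure_subset[of "{x\<in>{0..1}. f x \<noteq> 0}"] by (auto simp: W_def S_def)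
  have der0: "(W has_real_derivative 0) (at x)" if "x \<notin> S" for x
  proof -
    have "((\<lambda>_. 0) has_real_derivative 0) (at x)" by simp
    then show ?thesis
      by (rule has_field_derivative_transform_within_open[OF _ S(2)]) (use that W0 in auto)
  qed
  have der1: "(W has_real_derivative D 1 x) (at x)" if x: "x \<in> {0<..<1}" for x
  proof -
    have "(D 0 has_real_derivative D 1 x) (at x within {0..1})" using D[of x 0] x by simp
    moreover have "at x within {0..1} = at x"
      using x by (intro at_within_interior) simp
    ultimately have "(D 0 has_real_derivative D 1 x) (at x)" by simp
    then show ?thesis
      by (rule has_field_derivative_transform_within_open[of _ _ _ "{0<..<1}"]) (use x D0 in \<open>auto simp: W_def\<close>)
  qed
  have W'0: "W' x = 0" if "x \<notin> S" for x
    using DERIV_unique[OF der0[OF that] der1] by (auto simp: W'_def)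
  have der: "(W has_real_derivative W' x) (at x)" for x
  proof (cases "x \<in> {0<..<1}")
    case False
    then have "x \<notin> S" using S(1) by blast
    then show ?thesis using der0 W'0 by simp
  qed (use der1 in \<open>simp add: W'_def\<close>)
  have c1: "continuous_on {0<..<1} W'"
  proof -
    have "continuous_on {0..1} (D 1)" by (rule DERIV_continuous_on[OF D])
    then have "continuous_on {0<..<1} (D 1)" by (rule continuous_on_subset) auto
    then show ?thesis by (rule continuous_on_eq) (auto simp: W'_def)
  qed
  have c2: "continuous_on (- S) W'"
    by (rule continuous_on_eq[OF continuous_on_const[of _ 0]]) (use W'0 in auto)
  \<comment> \<open>The support \<open>S\<close> is a closed subset of the open interval, so the two open sets cover the line.\<close>
  have "continuous_on ({0<..<1} \<union> - S) W'"
    by (rule continuous_on_open_Un[OF _ S(2) c1 c2]) auto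
  moreover have "{0<..<1} \<union> - S = UNIV" using S(1) by auto
  ultimately have "continuous_on UNIV W'" by simp
  moreover have "W x = 0" if "x \<notin> {0<..<1}" for x using W0 S(1) that by blast
  ultimately show thesis
    by (intro that[of W W'] der) (auto simp: W_def W'_def)
qed

text \<open>
  A function with a different factor on every interval between consecutive integers, written near
  the integer \<open>N\<close> without floors as the sum of the two adjacent pieces. This shows that the pieces,
  which vanish at the integers, fit together smoothly.
\<close>

lemma floor_frac_glue:
  fixes \<kappa> :: "int \<Rightarrow> real" and g :: "real \<Rightarrow> real"
  assumes g: "\<And>y. y \<notin> {0<..<1} \<Longrightarrow> g y = 0" and \<tau>: "of_int N - 1 \<le> \<tau>" "\<tau> < of_int N + 1"
  shows "\<kappa> \<lfloor>\<tau>\<rfloor> * g (frac \<tau>) = \<kappa> N * g (\<tau> - of_int N) + \<kappa> (N - 1) * g (\<tau> - of_int N + 1)"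
proof (cases "\<tau> < of_int N")
  case True
  then have fl: "\<lfloor>\<tau>\<rfloor> = N - 1" using \<tau> by (simp add: floor_eq_iff)
  then have "frac \<tau> = \<tau> - of_int N + 1" by (simp add: frac_def)
  then show ?thesis using True g[of "\<tau> - of_int N"] by (simp add: fl)
next
  case False
  then have "\<lfloor>\<tau>\<rfloor> = N" using \<tau> by (simp add: floor_eq_iff)
  then show ?thesis using False g[of "\<tau> - of_int N + 1"] by (simp add: frac_def)
qed

lemma DERIV_floor_frac:
  fixes \<kappa> :: "int \<Rightarrow> real" and g :: "real \<Rightarrow> real"
  assumes der: "\<And>y. (g has_real_derivative g' y) (at y)"
    and g: "\<And>y. y \<notin> {0<..<1} \<Longrightarrow> g y = 0" and g': "\<And>y. y \<notin> {0<..<1} \<Longrightarrow> g' y = 0"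
  shows "((\<lambda>\<tau>. \<kappa> \<lfloor>\<tau>\<rfloor> * g (frac \<tau>)) has_real_derivative \<kappa> \<lfloor>\<tau>\<rfloor> * g' (frac \<tau>)) (at \<tau>)"
proof -
  define N where "N = \<lfloor>\<tau>\<rfloor>"
  have N: "of_int N \<le> \<tau>" "\<tau> < of_int N + 1" by (auto simp: N_def)
  have eq: "\<kappa> N * g (s - of_int N) + \<kappa> (N - 1) * g (s - of_int N + 1) = \<kappa> \<lfloor>s\<rfloor> * g (frac s)"
    if "s \<in> {of_int N - 1<..<of_int N + 1}" for s
    by (rule floor_frac_glue[where g = g, OF g, symmetric]) (use that in auto)
  have sh: "((\<lambda>\<tau>. g (\<tau> + s)) has_real_derivative g' (\<tau> + s)) (at \<tau>)" for s
    using der[of "\<tau> + s"] by (simp add: DERIV_shift)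
  have "((\<lambda>\<tau>. \<kappa> N * g (\<tau> - of_int N) + \<kappa> (N - 1) * g (\<tau> - of_int N + 1)) has_real_derivative
      \<kappa> N * g' (\<tau> - of_int N) + \<kappa> (N - 1) * g' (\<tau> - of_int N + 1)) (at \<tau>)"
    using DERIV_add[OF DERIV_cmult[OF sh[of "- of_int N"], of "\<kappa> N"] DERIV_cmult[OF sh[of "1 - of_int N"], of "\<kappa> (N - 1)"]]
    by (simp add: algebra_simps)
  also have "\<kappa> N * g' (\<tau> - of_int N) + \<kappa> (N - 1) * g' (\<tau> - of_int N + 1) = \<kappa> \<lfloor>\<tau>\<rfloor> * g' (frac \<tau>)"
    by (rule floor_frac_glue[where g = g', OF g', symmetric]) (use N in auto)
  finally show ?thesis
    by (rule has_field_derivative_transform_within_open[of _ _ _ "{of_int N - 1<..<of_int N + 1}"])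
      (use N eq in auto)
qed

lemma continuous_floor_frac:
  fixes \<kappa> :: "int \<Rightarrow> real" and g :: "real \<Rightarrow> real"
  assumes cont: "continuous_on UNIV g" and g: "\<And>y. y \<notin> {0<..<1} \<Longrightarrow> g y = 0"
  shows "continuous_on UNIV (\<lambda>\<tau>. \<kappa> \<lfloor>\<tau>\<rfloor> * g (frac \<tau>))"
  unfolding continuous_on_eq_continuous_at[OF open_UNIV]
proof
  fix \<tau> :: real
  define N where "N = \<lfloor>\<tau>\<rfloor>"
  let ?I = "{of_int N - 1<..<of_int N + 1} :: real set"
  have N: "\<tau> \<in> ?I" by (auto simp: N_def) linarith
  have eq: "\<kappa> N * g (s - of_int N) + \<kappa> (N - 1) * g (s - of_int N + 1) = \<kappa> \<lfloor>s\<rfloor> * g (frac s)"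
    if "s \<in> {of_int N - 1<..<of_int N + 1}" for s
    by (rule floor_frac_glue[where g = g, OF g, symmetric]) (use that in auto)
  have "continuous_on ?I (\<lambda>\<tau>. \<kappa> N * g (\<tau> - of_int N) + \<kappa> (N - 1) * g (\<tau> - of_int N + 1))"
    by (intro continuous_intros continuous_on_compose2[OF cont]) auto
  then have "continuous_on ?I (\<lambda>\<tau>. \<kappa> \<lfloor>\<tau>\<rfloor> * g (frac \<tau>))"
    by (rule continuous_on_eq) (rule eq)
  then show "isCont (\<lambda>\<tau>. \<kappa> \<lfloor>\<tau>\<rfloor> * g (frac \<tau>)) \<tau>"
    by (rule continuous_on_interior) (use N in simp)
qed

text \<open>
  Distance from the end of the interval at which component \<open>j\<close> enters.
\<close>

definition travelled :: "nat \<Rightarrow> nat \<Rightarrow> real \<Rightarrow> real" where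
  "travelled m j x = (if j < m then x else 1 - x)"

definition unit_speed :: "nat \<Rightarrow> nat \<Rightarrow> real" where
  "unit_speed m j = (if j < m then 1 else -1)"

text \<open>
  The solution of $v(t) = A\, v(t - 1)$ for $t \ge 0$ with $v(\tau) = W(\tau + 1)$ on
  $[-1, 0)$. The argument \<open>\<tau>\<close> is the time at which a wave enters the strip; waves present at time 0
  count as having entered between the times \<open>- 1\<close> and 0.
\<close>

definition inflow_trace :: "nat \<Rightarrow> real mat \<Rightarrow> (nat \<Rightarrow> real \<Rightarrow> real) \<Rightarrow> nat \<Rightarrow> real \<Rightarrow> real" where
  "inflow_trace n A W j \<tau> = (\<Sum>k<n. (A ^\<^sub>m nat (\<lfloor>\<tau>\<rfloor> + 1)) $$ (j, k) * W k (frac \<tau>))"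

text \<open>
  What is found at \<open>x\<close> at time \<open>t\<close> has entered at time \<open>t - travelled m j x\<close> and been damped since then.
\<close>

definition wave :: "nat \<Rightarrow> nat \<Rightarrow> real mat \<Rightarrow> (nat \<Rightarrow> real) \<Rightarrow> (nat \<Rightarrow> real \<Rightarrow> real) \<Rightarrow> nat \<Rightarrow> real \<times> real \<Rightarrow> real" where
  "wave n m A \<beta> W j = (\<lambda>(x, t). exp (- \<beta> j * travelled m j x) * inflow_trace n A W j (t - travelled m j x))"

definition damped_mat :: "nat \<Rightarrow> real mat \<Rightarrow> (nat \<Rightarrow> real) \<Rightarrow> real mat" where
  "damped_mat n P \<beta> = mat n n (\<lambda>(j, k). P $$ (j, k) * exp (- \<beta> k))"

text \<open>
  This makes the pieces of \<open>inflow_trace\<close> match to first order at integer times.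
\<close>

definition C1_profile :: "(real \<Rightarrow> real) \<Rightarrow> bool" where
  "C1_profile W \<longleftrightarrow> (\<exists>W'. (\<forall>x. (W has_real_derivative W' x) (at x)) \<and> continuous_on UNIV W' \<and>
     (\<forall>x. x \<notin> {0<..<1} \<longrightarrow> W x = 0 \<and> W' x = 0))"

lemma C1_profile_continuous:
  assumes "C1_profile W"
  shows "continuous_on UNIV W"
proof -
  obtain W' where "\<And>x. (W has_real_derivative W' x) (at x)"
    using assms by (auto simp: C1_profile_def)
  then show ?thesis by (rule DERIV_continuous_on)
qed

lemma C1_profile_zero: "C1_profile W \<Longrightarrow> x \<notin> {0<..<1} \<Longrightarrow> W x = 0"
  by (auto simp: C1_profile_def)

text \<open>
  The end points need care: for \<open>\<rho> = 0\<close> the floor is 0 and not \<open>- 1\<close>, and both sides vanish.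
\<close>

lemma inflow_trace_initial:
  assumes "A \<in> carrier_mat n n" "j < n" "\<And>k. k < n \<Longrightarrow> C1_profile (W k)" "\<rho> \<in> {0..1}"
  shows "inflow_trace n A W j (- \<rho>) = W j (1 - \<rho>)"
proof (cases "\<rho> = 0")
  case True
  then show ?thesis using assms by (simp add: inflow_trace_def C1_profile_zero)
next
  case False
  have fl: "\<lfloor>- \<rho>\<rfloor> = -1" using False assms by (simp add: floor_eq_iff)
  then have fr: "frac (- \<rho>) = 1 - \<rho>" by (simp add: frac_def)
  have "inflow_trace n A W j (- \<rho>) = (\<Sum>k<n. (if j = k then W k (1 - \<rho>) else 0))"
    unfolding inflow_trace_def fl fr using assms by (intro sum.cong) auto
  then show ?thesis using assms by simp
qed

lemma inflow_trace_step:
  assumes "A \<in> carrier_mat n n" "j < n" "0 \<le> t"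
  shows "inflow_trace n A W j t = (\<Sum>k<n. A $$ (j, k) * inflow_trace n A W k (t - 1))"
proof -
  define s where "s = nat \<lfloor>t\<rfloor>"
  have s: "nat (\<lfloor>t\<rfloor> + 1) = Suc s" "nat (\<lfloor>t - 1\<rfloor> + 1) = s" using assms by (auto simp: s_def nat_add_distrib)
  have fr: "frac (t - 1) = frac t" by (simp add: frac_def)
  have "inflow_trace n A W j t = (\<Sum>l<n. (\<Sum>k<n. A $$ (j, k) * (A ^\<^sub>m s) $$ (k, l)) * W l (frac t))"
    unfolding inflow_trace_def s using assms by (intro sum.cong refl) (simp add: pow_mat_Suc_left_entry del: pow_mat.simps)
  also have "\<dots> = (\<Sum>k<n. \<Sum>l<n. A $$ (j, k) * (A ^\<^sub>m s) $$ (k, l) * W l (frac t))"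
    by (subst sum.swap) (simp add: sum_distrib_right)
  also have "\<dots> = (\<Sum>k<n. A $$ (j, k) * inflow_trace n A W k (t - 1))"
    unfolding inflow_trace_def s fr by (simp add: sum_distrib_left mult.assoc)
  finally show ?thesis .
qed

lemma inflow_trace_C1:
  assumes "\<And>k. k < n \<Longrightarrow> C1_profile (W k)"
  shows "\<exists>V'. (\<forall>\<tau>. (inflow_trace n A W j has_real_derivative V' \<tau>) (at \<tau>)) \<and> continuous_on UNIV V'"
proof -
  have "\<exists>W'. \<forall>k<n. (\<forall>x. (W k has_real_derivative W' k x) (at x)) \<and> continuous_on UNIV (W' k) \<and>
     (\<forall>x. x \<notin> {0<..<1} \<longrightarrow> W k x = 0 \<and> W' k x = 0)"
    using assms unfolding C1_profile_def by metis
  then obtain W' where W': "\<And>k x. k < n \<Longrightarrow> (W k has_real_derivative W' k x) (at x)"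
    "\<And>k. k < n \<Longrightarrow> continuous_on UNIV (W' k)"
    "\<And>k x. k < n \<Longrightarrow> x \<notin> {0<..<1} \<Longrightarrow> W k x = 0" "\<And>k x. k < n \<Longrightarrow> x \<notin> {0<..<1} \<Longrightarrow> W' k x = 0"
    by blast
  show ?thesis
  proof (intro exI[of _ "\<lambda>\<tau>. \<Sum>k<n. (A ^\<^sub>m nat (\<lfloor>\<tau>\<rfloor> + 1)) $$ (j, k) * W' k (frac \<tau>)"] conjI allI)
    show "(inflow_trace n A W j has_real_derivative
        (\<Sum>k<n. (A ^\<^sub>m nat (\<lfloor>\<tau>\<rfloor> + 1)) $$ (j, k) * W' k (frac \<tau>))) (at \<tau>)" for \<tau>
      unfolding inflow_trace_def[abs_def]
      by (intro DERIV_sum DERIV_floor_frac[where \<kappa> = "\<lambda>N. (A ^\<^sub>m nat (N + 1)) $$ (j, _)"] W') auto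
    show "continuous_on UNIV (\<lambda>\<tau>. \<Sum>k<n. (A ^\<^sub>m nat (\<lfloor>\<tau>\<rfloor> + 1)) $$ (j, k) * W' k (frac \<tau>))"
      by (intro continuous_on_sum continuous_floor_frac[where \<kappa> = "\<lambda>N. (A ^\<^sub>m nat (N + 1)) $$ (j, _)"] W') auto
  qed
qed

lemma wave_solves_equation:
  assumes "\<And>k. k < n \<Longrightarrow> C1_profile (W k)"
  shows "\<exists>ux ut. C1_strip (wave n m A \<beta> W j) ux ut \<and>
    (\<forall>p. ut p + unit_speed m j * ux p + \<beta> j * wave n m A \<beta> W j p = 0)"
proof -
  obtain V' where V': "\<And>\<tau>. (inflow_trace n A W j has_real_derivative V' \<tau>) (at \<tau>)" "continuous_on UNIV V'"
    using inflow_trace_C1[where W = W and n = n and j = j and A = A, OF assms] by blast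
  let ?\<rho> = "travelled m j" and ?\<sigma> = "unit_speed m j" and ?V = "inflow_trace n A W j"
  have V: "continuous_on UNIV ?V" by (rule DERIV_continuous_on[OF V'(1)])
  define ut where "ut = (\<lambda>(x, t). exp (- \<beta> j * ?\<rho> x) * V' (t - ?\<rho> x))"
  define ux where "ux = (\<lambda>(x, t). - ?\<sigma> * (exp (- \<beta> j * ?\<rho> x) * (\<beta> j * ?V (t - ?\<rho> x) + V' (t - ?\<rho> x))))"
  have \<rho>': "(?\<rho> has_derivative (\<lambda>h. ?\<sigma> * h)) (at x within S)" for x S
    unfolding travelled_def[abs_def] unit_speed_def by (cases "j < m") (auto intro!: derivative_eq_intros)
  have \<rho>c: "continuous_on UNIV ?\<rho>"
    unfolding travelled_def[abs_def] by (cases "j < m") (auto intro!: continuous_intros)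
  have comp: "continuous_on strip (\<lambda>p. f (snd p - ?\<rho> (fst p)))" if "continuous_on UNIV f" for f :: "real \<Rightarrow> real"
    by (intro continuous_on_compose2[OF that] continuous_on_compose2[OF \<rho>c] continuous_intros) auto
  have e: "continuous_on strip (\<lambda>p. exp (- \<beta> j * ?\<rho> (fst p)))"
    by (intro continuous_on_compose2[OF \<rho>c] continuous_intros) auto
  have "C1_strip (wave n m A \<beta> W j) ux ut"
    unfolding C1_strip_def
  proof (intro conjI ballI)
    show "continuous_on strip ut"
      unfolding ut_def case_prod_unfold by (intro continuous_on_mult e comp V'(2))
    show "continuous_on strip ux"
      unfolding ux_def case_prod_unfold
      by (intro continuous_on_mult continuous_on_add continuous_on_const e comp V'(2) V)
    fix p :: "real \<times> real" assume "p \<in> strip"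
    obtain x t where p: "p = (x, t)" by (cases p)
    have f: "((\<lambda>p. ?\<rho> (fst p)) has_derivative (\<lambda>q. ?\<sigma> * fst q)) (at p within strip)"
      by (rule has_derivative_compose[OF has_derivative_fst[OF has_derivative_ident] \<rho>'])
    have 1: "((\<lambda>p. exp (- \<beta> j * ?\<rho> (fst p))) has_derivative
        (\<lambda>q. exp (- \<beta> j * ?\<rho> (fst p)) * (- \<beta> j * (?\<sigma> * fst q)))) (at p within strip)"
      using f by (auto intro!: derivative_eq_intros)
    have 2: "((\<lambda>p. ?V (snd p - ?\<rho> (fst p))) has_derivative
        (\<lambda>q. V' (snd p - ?\<rho> (fst p)) * (snd q - ?\<sigma> * fst q))) (at p within strip)"
      by (rule has_derivative_compose[OF has_derivative_diff[OF has_derivative_snd[OF has_derivative_ident] f]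
            V'(1)[THEN has_field_derivative_imp_has_derivative]])
    show "(wave n m A \<beta> W j has_derivative (\<lambda>(h, k). ux p * h + ut p * k)) (at p within strip)"
      unfolding wave_def case_prod_unfold
      by (rule has_derivative_eq_rhs[OF has_derivative_mult[OF 1 2]])
        (auto simp: ux_def ut_def p algebra_simps fun_eq_iff)
  qed
  moreover have "ut p + ?\<sigma> * ux p + \<beta> j * wave n m A \<beta> W j p = 0" for p
    by (cases p) (auto simp: ut_def ux_def wave_def unit_speed_def algebra_simps)
  ultimately show ?thesis by blast
qed

text \<open>
  The boundary conditions are the recursion of the traces: at unit speed, the outflow of component
  \<open>k\<close> at time \<open>t\<close> is what entered at time \<open>t - 1\<close>, multiplied by \<open>exp (- \<beta> k)\<close>.
\<close>

lemma wave_classical_solution: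
  assumes P: "P \<in> carrier_mat n n" and mn: "m \<le> n" and W: "\<And>k. k < n \<Longrightarrow> C1_profile (W k)"
    and \<phi>: "\<And>j x. j < n \<Longrightarrow> x \<in> {0..1} \<Longrightarrow> \<phi> j x = exp (- \<beta> j * travelled m j x) * W j (1 - travelled m j x)"
  shows "classical_solution n m P (\<lambda>j _. unit_speed m j) (\<lambda>j _. \<beta> j) \<phi> (wave n m (damped_mat n P \<beta>) \<beta> W)"
proof -
  let ?A = "damped_mat n P \<beta>"
  let ?u = "wave n m ?A \<beta> W"
  have A: "?A \<in> carrier_mat n n" by (simp add: damped_mat_def)
  have bc: "inflow_trace n ?A W j t =
      (\<Sum>k<m. P $$ (j, k) * ?u k (1, t)) + (\<Sum>k=m..<n. P $$ (j, k) * ?u k (0, t))"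
    if "j < n" "0 \<le> t" for j t
  proof -
    have "inflow_trace n ?A W j t = (\<Sum>k<n. P $$ (j, k) * (exp (- \<beta> k) * inflow_trace n ?A W k (t - 1)))"
      unfolding inflow_trace_step[OF A that] using that by (intro sum.cong) (auto simp: damped_mat_def)
    also have "{..<n} = {..<m} \<union> {m..<n}" using mn by auto
    also have "(\<Sum>k\<in>{..<m} \<union> {m..<n}. P $$ (j, k) * (exp (- \<beta> k) * inflow_trace n ?A W k (t - 1))) =
        (\<Sum>k<m. P $$ (j, k) * (exp (- \<beta> k) * inflow_trace n ?A W k (t - 1))) +
        (\<Sum>k=m..<n. P $$ (j, k) * (exp (- \<beta> k) * inflow_trace n ?A W k (t - 1)))"
      by (rule sum.union_disjoint) auto
    also have "\<dots> = (\<Sum>k<m. P $$ (j, k) * ?u k (1, t)) + (\<Sum>k=m..<n. P $$ (j, k) * ?u k (0, t))"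
      by (intro arg_cong2[where f = "(+)"] sum.cong) (auto simp: wave_def travelled_def)
    finally show ?thesis .
  qed
  have "?u j (0, t) = inflow_trace n ?A W j t" if "j < m" for j t
    using that by (simp add: wave_def travelled_def)
  moreover have "?u j (1, t) = inflow_trace n ?A W j t" if "j \<ge> m" for j t
    using that by (simp add: wave_def travelled_def)
  moreover have "?u j (x, 0) = \<phi> j x" if "j < n" "x \<in> {0..1}" for j x
    using inflow_trace_initial[where W = W and \<rho> = "travelled m j x", OF A that(1) W] that \<phi>[OF that]
    by (auto simp: wave_def travelled_def)
  moreover have "\<exists>ux ut. C1_strip (?u j) ux ut \<and>
        (\<forall>x t. 0 < x \<and> x < 1 \<and> 0 < t \<longrightarrow>
           ut (x, t) + unit_speed m j * ux (x, t) + \<beta> j * ?u j (x, t) = 0)" for j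
    using wave_solves_equation[where W = W and n = n and m = m and A = ?A and \<beta> = \<beta> and j = j, OF W] by blast
  ultimately show ?thesis
    unfolding classical_solution_def using bc mn by auto
qed

section \<open>$L^2$ stability and generalized solutions\<close>

lemma integral_I01_eq:
  fixes F :: "real \<Rightarrow> real"
  assumes "continuous_on UNIV F"
  shows "(\<integral>x. F x \<partial>I01) = (\<integral>x. indicator {0<..<1} x * F x \<partial>lborel)"
proof -
  have [measurable]: "F \<in> borel_measurable borel"
    using assms by (rule borel_measurable_continuous_onI)
  have "(\<integral>x. F x \<partial>I01) = (\<integral>x. indicator {0<..<1} x *\<^sub>R F x \<partial>lebesgue)"
    by (rule Bochner_Integration.integral_restrict_space) auto
  also have "\<dots> = (\<integral>x. indicator {0<..<1} x *\<^sub>R F x \<partial>lborel)"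
    by (rule integral_completion) measurable
  finally show ?thesis by simp
qed

lemma integrable_supported:
  fixes F :: "real \<Rightarrow> real"
  assumes "continuous_on UNIV F" and F0: "\<And>y. y \<notin> {0<..<1} \<Longrightarrow> F y = 0"
  shows "integrable lborel F"
proof -
  have "integrable lborel (\<lambda>x. indicator {0..1} x *\<^sub>R F x)"
    by (rule borel_integrable_compact) (use assms(1) in \<open>auto intro: continuous_on_subset\<close>)
  also have "(\<lambda>x. indicator {0..1} x *\<^sub>R F x) = F"
  proof
    fix x show "indicator {0..1} x *\<^sub>R F x = F x"
      using F0[of x] by (cases "x \<in> {0<..<1}") (auto simp: indicator_def)
  qed
  finally show ?thesis .
qed

lemma travelled_affine: "s - travelled m j x = (s - (if j < m then 0 else 1)) + - unit_speed m j * x"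
  by (simp add: travelled_def unit_speed_def)

lemma integral_travelled:
  fixes F :: "real \<Rightarrow> real"
  shows "(\<integral>x. F (s - travelled m j x) \<partial>lborel) = (\<integral>y. F y \<partial>lborel)"
  unfolding travelled_affine[of s]
  using lborel_integral_real_affine[of "- unit_speed m j" F "s - (if j < m then 0 else 1)"]
  by (simp add: unit_speed_def split: if_splits)

lemma integrable_travelled:
  fixes F :: "real \<Rightarrow> real"
  assumes "integrable lborel F"
  shows "integrable lborel (\<lambda>x. F (s - travelled m j x))"
  unfolding travelled_affine[of s]
  using lborel_integrable_real_affine[OF assms, of "- unit_speed m j" "s - (if j < m then 0 else 1)"]
  by (simp add: unit_speed_def split: if_splits)

lemma continuous_travelled: "continuous_on S (travelled m j)"
  unfolding travelled_def[abs_def] by (cases "j < m") (auto intro!: continuous_intros)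

text \<open>
  Over one crossing, the fractional part runs through at most two adjacent periods, and each of them
  contributes no more than the full integral of \<open>F\<close>.
\<close>

lemma integral_profile_le:
  fixes F :: "real \<Rightarrow> real"
  assumes cont: "continuous_on UNIV F" and F0: "\<And>y. y \<notin> {0<..<1} \<Longrightarrow> F y = 0" and nonneg: "\<And>y. 0 \<le> F y"
  shows "(\<integral>x. F (frac (t - travelled m j x)) \<partial>I01) \<le> 2 * (\<integral>y. F y \<partial>lborel)"
proof -
  define N where "N = \<lfloor>t\<rfloor>"
  let ?r = "travelled m j"
  have int: "integrable lborel F" by (rule integrable_supported[OF cont F0])
  have fr: "continuous_on UNIV (\<lambda>\<tau>. F (frac \<tau>))"
    using continuous_floor_frac[OF cont F0, of "\<lambda>_. 1"] by simp
  have c: "continuous_on UNIV (\<lambda>x. F (frac (t - ?r x)))"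
    by (intro continuous_on_compose2[OF fr] continuous_intros continuous_travelled) auto
  have "(\<integral>x. F (frac (t - ?r x)) \<partial>I01) = (\<integral>x. indicator {0<..<1} x * F (frac (t - ?r x)) \<partial>lborel)"
    by (rule integral_I01_eq[OF c])
  also have "\<dots> \<le> (\<integral>x. F ((t - of_int N) - ?r x) + F ((t - of_int N + 1) - ?r x) \<partial>lborel)"
  proof (rule Bochner_Integration.integral_mono')
    show "integrable lborel (\<lambda>x. F ((t - of_int N) - ?r x) + F ((t - of_int N + 1) - ?r x))"
      by (intro Bochner_Integration.integrable_add integrable_travelled int)
    fix x
    show "0 \<le> F ((t - of_int N) - ?r x) + F ((t - of_int N + 1) - ?r x)"
      using nonneg by (intro add_nonneg_nonneg)
    show "indicator {0<..<1} x * F (frac (t - ?r x)) \<le> F ((t - of_int N) - ?r x) + F ((t - of_int N + 1) - ?r x)"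
    proof (cases "x \<in> {0<..<1}")
      case True
      then have "?r x \<in> {0<..<1}" by (auto simp: travelled_def)
      moreover have "of_int N \<le> t" "t < of_int N + 1" by (auto simp: N_def)
      ultimately have "of_int N - 1 \<le> t - ?r x" "t - ?r x < of_int N + 1" by auto
      from floor_frac_glue[where g = F and \<kappa> = "\<lambda>_. 1", OF F0 this]
      have "F (frac (t - ?r x)) = F ((t - of_int N) - ?r x) + F ((t - of_int N + 1) - ?r x)"
        by (simp add: algebra_simps)
      then show ?thesis using True by simp
    qed (use nonneg in auto)
  qed
  also have "\<dots> = 2 * (\<integral>y. F y \<partial>lborel)"
    by (subst Bochner_Integration.integral_add) (auto simp: integral_travelled intro!: integrable_travelled int)
  finally show ?thesis .
qed

lemma integral_profile_eq:
  fixes F :: "real \<Rightarrow> real"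
  assumes cont: "continuous_on UNIV F" and F0: "\<And>y. y \<notin> {0<..<1} \<Longrightarrow> F y = 0"
  shows "(\<integral>x. F (1 - travelled m j x) \<partial>I01) = (\<integral>y. F y \<partial>lborel)"
proof -
  have c: "continuous_on UNIV (\<lambda>x. F (1 - travelled m j x))"
    by (intro continuous_on_compose2[OF cont] continuous_intros continuous_travelled) auto
  have "(\<integral>x. F (1 - travelled m j x) \<partial>I01) = (\<integral>x. indicator {0<..<1} x * F (1 - travelled m j x) \<partial>lborel)"
    by (rule integral_I01_eq[OF c])
  also have "\<dots> = (\<integral>x. F (1 - travelled m j x) \<partial>lborel)"
  proof (intro Bochner_Integration.integral_cong refl)
    fix x
    show "indicator {0<..<1} x * F (1 - travelled m j x) = F (1 - travelled m j x)"
      using F0[of "1 - travelled m j x"] by (cases "x \<in> {0<..<1}") (auto simp: travelled_def split: if_splits)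
  qed
  finally show ?thesis by (simp add: integral_travelled)
qed

lemma integrable_I01_continuous:
  fixes F :: "real \<Rightarrow> real"
  assumes "continuous_on {0..1} F"
  shows "integrable I01 F"
proof -
  have "F absolutely_integrable_on {0..1}"
    using absolutely_integrable_continuous_real assms by blast
  then have "F absolutely_integrable_on {0<..<1}"
    by (rule set_integrable_subset) auto
  then show ?thesis by (simp add: integrable_restrict_space set_integrable_def)
qed

text \<open>
  On a bounded time interval only finitely many powers of \<open>A\<close> occur. They bound the solution pointwise
  by the profiles, whose norms are comparable to those of the initial data. The constant is
  independent of the profiles, so by linearity the solution depends continuously on the data.
\<close>

lemma wave_L2_estimate:
  assumes "0 < n" and \<beta>: "\<And>j. j < n \<Longrightarrow> 0 \<le> \<beta> j"
  shows "\<exists>C\<ge>0. \<forall>W t. (\<forall>k<n. C1_profile (W k)) \<longrightarrow> t \<in> {0..T} \<longrightarrow>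
    L2_norm_n n (\<lambda>j x. wave n m A \<beta> W j (x, t)) \<le>
      C * L2_norm_n n (\<lambda>j x. exp (- \<beta> j * travelled m j x) * W j (1 - travelled m j x))"
proof -
  define X where "X = (\<lambda>(s, j, k). \<bar>(A ^\<^sub>m s) $$ (j, k)\<bar>) ` ({..nat \<lceil>T\<rceil> + 1} \<times> {..<n} \<times> {..<n})"
  \<comment> \<open>A bound for the entries of all powers that occur up to the time \<open>T\<close>.\<close>
  define M where "M = Max (insert 0 X)"
  have finX: "finite X" by (simp add: X_def)
  have M0: "0 \<le> M" unfolding M_def using finX by (intro Max_ge) auto
  have M: "\<bar>(A ^\<^sub>m s) $$ (j, k)\<bar> \<le> M" if "s \<le> nat \<lceil>T\<rceil> + 1" "j < n" "k < n" for s j k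
  proof -
    have "\<bar>(A ^\<^sub>m s) $$ (j, k)\<bar> \<in> X" unfolding X_def using that by (force intro: image_eqI[of _ _ "(s, j, k)"])
    then show ?thesis unfolding M_def using finX by (intro Max_ge) auto
  qed
  define E where "E = (\<Sum>k<n. exp (\<beta> k))"
  have E: "exp (\<beta> k) \<le> E" if "k < n" for k
    unfolding E_def using that by (intro member_le_sum) auto
  have E0: "0 \<le> E" unfolding E_def by (intro sum_nonneg) auto
  define C where "C = sqrt (2 * (M\<^sup>2 * real n) * real n) * E"
  have C0: "0 \<le> C" using E0 by (simp add: C_def)
  show ?thesis
  proof (intro exI[of _ C] conjI C0 allI impI)
    fix W :: "nat \<Rightarrow> real \<Rightarrow> real" and t :: real
    assume "\<forall>k<n. C1_profile (W k)" and t: "t \<in> {0..T}"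
    then have W: "\<And>k. k < n \<Longrightarrow> C1_profile (W k)" by blast
    define \<phi> where "\<phi> j x = exp (- \<beta> j * travelled m j x) * W j (1 - travelled m j x)" for j x
    have Wc: "continuous_on UNIV (\<lambda>y. (W k y)\<^sup>2)" if "k < n" for k
      by (intro continuous_intros C1_profile_continuous W that)
    have W0: "(W k y)\<^sup>2 = 0" if "k < n" "y \<notin> {0<..<1}" for k y
      using C1_profile_zero[OF W[OF that(1)] that(2)] by simp
    have \<phi>_norm: "(\<integral>y. (W k y)\<^sup>2 \<partial>lborel) \<le> (E * L2_norm_n n \<phi>)\<^sup>2" if k: "k < n" for k
    proof -
      have "(\<integral>y. (W k y)\<^sup>2 \<partial>lborel) = (\<integral>x. (W k (1 - travelled m k x))\<^sup>2 \<partial>I01)"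
        by (rule integral_profile_eq[OF Wc[OF k] W0[OF k], symmetric])
      also have "\<dots> \<le> (\<integral>x. E\<^sup>2 * (\<phi> k x)\<^sup>2 \<partial>I01)"
      proof (rule Bochner_Integration.integral_mono')
        have "continuous_on {0..1} (\<lambda>x. E\<^sup>2 * (\<phi> k x)\<^sup>2)"
          unfolding \<phi>_def
          by (intro continuous_intros continuous_on_compose2[OF C1_profile_continuous[OF W[OF k]]] continuous_travelled) auto
        then show "integrable I01 (\<lambda>x. E\<^sup>2 * (\<phi> k x)\<^sup>2)" by (rule integrable_I01_continuous)
        fix x assume "x \<in> space I01"
        then have "x \<in> {0<..<1}" by (simp add: space_restrict_space)
        then have r: "travelled m k x \<le> 1" by (auto simp: travelled_def)
        have "exp (\<beta> k * travelled m k x) \<le> exp (\<beta> k)"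
          using mult_left_mono[OF r \<beta>[OF k]] by simp
        also have "\<dots> \<le> E" by (rule E[OF k])
        finally have e: "exp (\<beta> k * travelled m k x) \<le> E" .
        have "W k (1 - travelled m k x) = exp (\<beta> k * travelled m k x) * \<phi> k x"
          by (simp add: \<phi>_def mult.assoc[symmetric] exp_add[symmetric])
        then have "(W k (1 - travelled m k x))\<^sup>2 = (exp (\<beta> k * travelled m k x))\<^sup>2 * (\<phi> k x)\<^sup>2"
          by (simp add: power_mult_distrib)
        also have "\<dots> \<le> E\<^sup>2 * (\<phi> k x)\<^sup>2"
          using e by (intro mult_right_mono power_mono) auto
        finally show "(W k (1 - travelled m k x))\<^sup>2 \<le> E\<^sup>2 * (\<phi> k x)\<^sup>2" .
      qed auto
      also have "\<dots> = E\<^sup>2 * (L2_norm (\<phi> k))\<^sup>2" by (simp add: L2_norm_power2)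
      also have "\<dots> \<le> E\<^sup>2 * (L2_norm_n n \<phi>)\<^sup>2"
        by (intro mult_left_mono power_mono L2_norm_le_n k L2_norm_nonneg) auto
      finally show ?thesis by (simp add: power_mult_distrib)
    qed
    have "L2_norm (\<lambda>x. wave n m A \<beta> W j (x, t)) \<le> C * L2_norm_n n \<phi>" if j: "j < n" for j
    proof (rule power2_le_imp_le)
      let ?r = "travelled m j"
      have fr: "continuous_on UNIV (\<lambda>\<tau>. (W k (frac \<tau>))\<^sup>2)" if "k < n" for k
        using continuous_floor_frac[OF Wc[OF that] W0[OF that], of "\<lambda>_. 1"] by simp
      have int: "integrable I01 (\<lambda>x. (W k (frac (t - ?r x)))\<^sup>2)" if "k < n" for k
        by (intro integrable_I01_continuous continuous_on_compose2[OF fr[OF that]] continuous_intros continuous_travelled) auto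
      have "(L2_norm (\<lambda>x. wave n m A \<beta> W j (x, t)))\<^sup>2 = (\<integral>x. (wave n m A \<beta> W j (x, t))\<^sup>2 \<partial>I01)"
        by (rule L2_norm_power2)
      also have "\<dots> \<le> (\<integral>x. (M\<^sup>2 * real n) * (\<Sum>k<n. (W k (frac (t - ?r x)))\<^sup>2) \<partial>I01)"
      proof (rule Bochner_Integration.integral_mono')
        show "integrable I01 (\<lambda>x. (M\<^sup>2 * real n) * (\<Sum>k<n. (W k (frac (t - ?r x)))\<^sup>2))"
          using int by (intro integrable_mult_right Bochner_Integration.integrable_sum) auto
        fix x assume "x \<in> space I01"
        then have "x \<in> {0<..<1}" by (simp add: space_restrict_space)
        then have r: "?r x \<in> {0<..<1}" by (auto simp: travelled_def)
        have "(0 :: real) \<le> \<beta> j * ?r x" using \<beta>[OF j] r by (intro mult_nonneg_nonneg) auto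
        then have e: "exp (- \<beta> j * ?r x) \<le> 1" by simp
        have "\<bar>inflow_trace n A W j (t - ?r x)\<bar> \<le>
            (\<Sum>k<n. M * \<bar>W k (frac (t - ?r x))\<bar>)"
          unfolding inflow_trace_def
        proof (rule order_trans[OF sum_abs], rule sum_mono)
          fix k assume "k \<in> {..<n}"
          have "\<lfloor>t - ?r x\<rfloor> \<le> \<lceil>T\<rceil>" using t r by (auto simp: floor_le_iff) linarith
          then have "nat (\<lfloor>t - ?r x\<rfloor> + 1) \<le> nat \<lceil>T\<rceil> + 1" by linarith
          from M[OF this j, of k]
          show "\<bar>(A ^\<^sub>m nat (\<lfloor>t - ?r x\<rfloor> + 1)) $$ (j, k) * W k (frac (t - ?r x))\<bar> \<le> M * \<bar>W k (frac (t - ?r x))\<bar>"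
            using \<open>k \<in> {..<n}\<close> unfolding abs_mult by (intro mult_right_mono) auto
        qed
        then have "\<bar>wave n m A \<beta> W j (x, t)\<bar> \<le> 1 * (M * (\<Sum>k<n. \<bar>W k (frac (t - ?r x))\<bar>))"
          unfolding wave_def case_prod_conv abs_mult sum_distrib_left[symmetric]
          using e by (intro mult_mono) auto
        then have "(wave n m A \<beta> W j (x, t))\<^sup>2 \<le> (M * (\<Sum>k<n. \<bar>W k (frac (t - ?r x))\<bar>))\<^sup>2"
          by (intro power2_le_iff_abs_le[THEN iffD2]) (auto intro!: mult_nonneg_nonneg sum_nonneg M0)
        also have "\<dots> = M\<^sup>2 * (\<Sum>k<n. \<bar>W k (frac (t - ?r x))\<bar>)\<^sup>2" by (simp add: power_mult_distrib)
        also have "\<dots> \<le> M\<^sup>2 * ((\<Sum>k<n. \<bar>W k (frac (t - ?r x))\<bar>\<^sup>2) * card {..<n})"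
          by (intro mult_left_mono sum_squared_le_sum_of_squares) auto
        finally show "(wave n m A \<beta> W j (x, t))\<^sup>2 \<le> (M\<^sup>2 * real n) * (\<Sum>k<n. (W k (frac (t - ?r x)))\<^sup>2)"
          by (simp add: algebra_simps)
      qed (auto intro!: mult_nonneg_nonneg sum_nonneg)
      also have "\<dots> = (M\<^sup>2 * real n) * (\<Sum>k<n. \<integral>x. (W k (frac (t - ?r x)))\<^sup>2 \<partial>I01)"
        using int by (simp add: Bochner_Integration.integral_sum)
      also have "\<dots> \<le> (M\<^sup>2 * real n) * (\<Sum>k<n. 2 * (E * L2_norm_n n \<phi>)\<^sup>2)"
      proof (intro mult_left_mono sum_mono)
        fix k assume "k \<in> {..<n}"
        then have k: "k < n" by simp
        have "(\<integral>x. (W k (frac (t - ?r x)))\<^sup>2 \<partial>I01) \<le> 2 * (\<integral>y. (W k y)\<^sup>2 \<partial>lborel)"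
          by (rule integral_profile_le[OF Wc[OF k] W0[OF k]]) auto
        then show "(\<integral>x. (W k (frac (t - ?r x)))\<^sup>2 \<partial>I01) \<le> 2 * (E * L2_norm_n n \<phi>)\<^sup>2"
          using \<phi>_norm[OF k] by linarith
      qed auto
      also have "\<dots> = (C * L2_norm_n n \<phi>)\<^sup>2"
        by (simp add: C_def power_mult_distrib)
      finally show "(L2_norm (\<lambda>x. wave n m A \<beta> W j (x, t)))\<^sup>2 \<le> (C * L2_norm_n n \<phi>)\<^sup>2" .
      have "0 \<le> L2_norm_n n \<phi>" using L2_norm_le_n[OF j, of \<phi>] L2_norm_nonneg[of "\<phi> j"] by linarith
      then show "0 \<le> C * L2_norm_n n \<phi>" using C0 by simp
    qed
    then show "L2_norm_n n (\<lambda>j x. wave n m A \<beta> W j (x, t)) \<le>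
      C * L2_norm_n n (\<lambda>j x. exp (- \<beta> j * travelled m j x) * W j (1 - travelled m j x))"
      unfolding \<phi>_def[abs_def, symmetric] by (intro L2_norm_n_leI assms(1))
  qed
qed

lemma L2_norm_le_bound:
  assumes "0 \<le> c" "\<And>x. x \<in> {0<..<1} \<Longrightarrow> \<bar>f x\<bar> \<le> c"
  shows "L2_norm f \<le> c"
proof -
  interpret finite_measure I01 by (rule finite_measure_I01)
  have "(\<integral>x. (f x)\<^sup>2 \<partial>I01) \<le> (\<integral>x. c\<^sup>2 \<partial>I01)"
  proof (rule Bochner_Integration.integral_mono')
    fix x assume "x \<in> space I01"
    then have "\<bar>f x\<bar> \<le> c" using assms(2) by (simp add: space_restrict_space)
    then show "(f x)\<^sup>2 \<le> c\<^sup>2" using assms(1) by (intro power2_le_iff_abs_le[THEN iffD2])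
  qed auto
  also have "\<dots> = c\<^sup>2"
    by (simp add: measure_restrict_space space_restrict_space)
  finally show ?thesis
    unfolding L2_norm_def using assms(1) by (intro real_le_lsqrt) auto
qed

lemma L2_fun_continuous:
  assumes "continuous_on {0..1} f"
  shows "L2_fun f"
  unfolding L2_fun_def
  using integrable_I01_continuous[OF assms] integrable_I01_continuous[OF continuous_on_power[OF assms, of 2]]
  by (auto intro: borel_measurable_integrable)

lemma continuous_L2_of_continuous:
  assumes v: "continuous_on strip v"
  shows "continuous_L2 v"
  unfolding continuous_L2_def
proof (intro conjI allI impI)
  fix t :: real assume t: "0 \<le> t"
  show "L2_fun (\<lambda>x. v (x, t))"
    using t by (intro L2_fun_continuous continuous_on_compose2[OF v] continuous_intros) (auto simp: strip_def)
  let ?K = "{0..1} \<times> {0..t + 1} :: (real \<times> real) set"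
  have "uniformly_continuous_on ?K v"
    by (intro compact_uniformly_continuous compact_Times compact_Icc continuous_on_subset[OF v])
      (auto simp: strip_def)
  show "((\<lambda>s. L2_norm (\<lambda>x. v (x, s) - v (x, t))) \<longlongrightarrow> 0) (at t within {0..})"
  proof (rule tendstoI)
    fix e :: real assume e: "0 < e"
    then have "0 < e / 2" by simp
    then obtain d where d: "0 < d" "\<And>p q. p \<in> ?K \<Longrightarrow> q \<in> ?K \<Longrightarrow> dist p q < d \<Longrightarrow> dist (v p) (v q) < e / 2"
      using \<open>uniformly_continuous_on ?K v\<close> unfolding uniformly_continuous_on_def by metis
    have "\<forall>\<^sub>F s in at t within {0..}. s \<in> {0..} \<and> dist s t < min d 1"
      using d(1) by (auto simp: eventually_at intro!: exI[of _ "min d 1"])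
    then show "\<forall>\<^sub>F s in at t within {0..}. dist (L2_norm (\<lambda>x. v (x, s) - v (x, t))) 0 < e"
    proof eventually_elim
      case (elim s)
      have "L2_norm (\<lambda>x. v (x, s) - v (x, t)) \<le> e / 2"
      proof (rule L2_norm_le_bound)
        fix x :: real assume x: "x \<in> {0<..<1}"
        have "dist (v (x, s)) (v (x, t)) < e / 2"
          by (rule d(2)) (use x t elim in \<open>auto simp: dist_Pair_Pair dist_real_def\<close>)
        then show "\<bar>v (x, s) - v (x, t)\<bar> \<le> e / 2" by (simp add: dist_real_def)
      qed (use e in simp)
      then show ?case using e L2_norm_nonneg[of "\<lambda>x. v (x, s) - v (x, t)"] by simp
    qed
  qed
qed

lemma C1_profile_diff:
  assumes "C1_profile V" "C1_profile W"
  shows "C1_profile (\<lambda>y. V y - W y)"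
proof -
  obtain V' W' where "\<forall>x. (V has_real_derivative V' x) (at x)" "continuous_on UNIV V'"
      "\<forall>x. x \<notin> {0<..<1} \<longrightarrow> V x = 0 \<and> V' x = 0"
    and "\<forall>x. (W has_real_derivative W' x) (at x)" "continuous_on UNIV W'"
      "\<forall>x. x \<notin> {0<..<1} \<longrightarrow> W x = 0 \<and> W' x = 0"
    using assms unfolding C1_profile_def by metis
  then show ?thesis
    unfolding C1_profile_def
    by (intro exI[of _ "\<lambda>x. V' x - W' x"]) (auto intro: DERIV_diff continuous_on_diff)
qed

text \<open>
  Initial data and profiles determine each other: the profile is the initial value without the damping, read
  in the order of entrance.
\<close>

lemma C1_profile_of_initial_data:
  assumes "C0_infinity f"
  obtains W where "C1_profile W"
    "\<And>x. x \<in> {0..1} \<Longrightarrow> exp (- b * travelled m j x) * W (1 - travelled m j x) = f x"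
proof -
  obtain G G' where G: "\<And>x. (G has_real_derivative G' x) (at x)" "continuous_on UNIV G'"
    "\<And>x. x \<in> {0..1} \<Longrightarrow> G x = f x" "\<And>x. x \<notin> {0<..<1} \<Longrightarrow> G x = 0" "\<And>x. x \<notin> {0<..<1} \<Longrightarrow> G' x = 0"
    using C0_infinity_extension[OF assms] by metis
  let ?r = "\<lambda>y. travelled m j (1 - y)"
  have inv: "travelled m j (travelled m j x) = x" for x by (simp add: travelled_def)
  have r01: "?r y \<in> {0<..<1} \<longleftrightarrow> y \<in> {0<..<1}" for y by (auto simp: travelled_def)
  have rd: "(?r has_real_derivative - unit_speed m j) (at y)" for y
    unfolding travelled_def unit_speed_def by (cases "j < m") (auto intro!: derivative_eq_intros)
  have rc: "continuous_on UNIV ?r"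
    by (rule DERIV_continuous_on[OF rd])
  have Gc: "continuous_on UNIV G" by (rule DERIV_continuous_on[OF G(1)])
  define W where "W y = exp (b * (1 - y)) * G (?r y)" for y
  define W' where "W' y = exp (b * (1 - y)) * (- b) * G (?r y) + G' (?r y) * (- unit_speed m j) * exp (b * (1 - y))" for y
  have "C1_profile W"
    unfolding C1_profile_def
  proof (intro exI[of _ W'] conjI allI impI)
    show "(W has_real_derivative W' y) (at y)" for y
      unfolding W_def[abs_def] W'_def
    proof (rule DERIV_mult)
      show "((\<lambda>y. exp (b * (1 - y))) has_real_derivative exp (b * (1 - y)) * (- b)) (at y)"
        by (auto intro!: derivative_eq_intros)
      show "((\<lambda>y. G (?r y)) has_real_derivative G' (?r y) * (- unit_speed m j)) (at y)"
        by (rule DERIV_chain2[OF G(1) rd])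
    qed
    show "continuous_on UNIV W'"
      unfolding W'_def[abs_def]
      by (intro continuous_intros continuous_on_compose2[OF Gc rc] continuous_on_compose2[OF G(2) rc]) auto
    show "W y = 0" "W' y = 0" if "y \<notin> {0<..<1}" for y
      using G(4,5)[of "?r y"] r01[of y] that by (auto simp: W_def W'_def)
  qed
  moreover have "exp (- b * travelled m j x) * W (1 - travelled m j x) = f x" if "x \<in> {0..1}" for x
    using G(3)[OF that] by (simp add: W_def inv mult.assoc[symmetric] exp_add[symmetric])
  ultimately show thesis by (rule that)
qed

lemma wave_diff:
  "wave n m A \<beta> V j p - wave n m A \<beta> W j p = wave n m A \<beta> (\<lambda>k y. V k y - W k y) j p"
  by (cases p) (simp add: wave_def inflow_trace_def right_diff_distrib sum_subtractf)

lemma wave_continuous: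
  assumes "\<And>k. k < n \<Longrightarrow> C1_profile (W k)"
  shows "continuous_on strip (wave n m A \<beta> W j)"
proof -
  obtain ux ut where "C1_strip (wave n m A \<beta> W j) ux ut"
    using wave_solves_equation[where W = W and n = n and m = m and A = A and \<beta> = \<beta> and j = j, OF assms] by blast
  then show ?thesis
    unfolding C1_strip_def by (meson has_derivative_continuous continuous_on_eq_continuous_within)
qed

text \<open>
  The classical solutions for approximating data are waves too, and so are their differences from
  the given one; the $L^2$ estimate then gives the convergence.
\<close>

lemma wave_generalized_solution:
  assumes P: "P \<in> carrier_mat n n" and mn: "m \<le> n" and "0 < n"
    and \<beta>: "\<And>j. j < n \<Longrightarrow> 0 \<le> \<beta> j" and W: "\<And>k. k < n \<Longrightarrow> C1_profile (W k)"
  shows "L2_generalized_solution n m P (\<lambda>j _. unit_speed m j) (\<lambda>j _. \<beta> j)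
    (\<lambda>j x. exp (- \<beta> j * travelled m j x) * W j (1 - travelled m j x)) (wave n m (damped_mat n P \<beta>) \<beta> W)"
  unfolding L2_generalized_solution_def
proof (intro conjI allI impI)
  show "continuous_L2 (wave n m (damped_mat n P \<beta>) \<beta> W j)" for j
    by (intro continuous_L2_of_continuous wave_continuous W)
next
  fix \<phi>l :: "nat \<Rightarrow> nat \<Rightarrow> real \<Rightarrow> real"
  let ?\<phi> = "\<lambda>j x. exp (- \<beta> j * travelled m j x) * W j (1 - travelled m j x)"
  let ?A = "damped_mat n P \<beta>"
  assume C0: "\<forall>l. \<forall>j<n. C0_infinity (\<phi>l l j)"
    and lim: "(\<lambda>l. L2_norm_n n (\<lambda>j x. \<phi>l l j x - ?\<phi> j x)) \<longlonglongrightarrow> 0"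
  let ?data = "\<lambda>l j V. C1_profile V \<and>
    (\<forall>x\<in>{0..1}. exp (- \<beta> j * travelled m j x) * V (1 - travelled m j x) = \<phi>l l j x)"
  define V where "V l j = (SOME V. ?data l j V)" for l j
  have data: "?data l j (V l j)" if j: "j < n" for l j
  proof -
    have "C0_infinity (\<phi>l l j)" using C0 j by blast
    then have "\<exists>V. ?data l j V" by (rule C1_profile_of_initial_data[of _ "\<beta> j" m j]) blast
    then show ?thesis unfolding V_def by (rule someI_ex)
  qed
  have V: "C1_profile (V l j)" if "j < n" for l j using data[OF that] by blast
  have V\<phi>: "exp (- \<beta> j * travelled m j x) * V l j (1 - travelled m j x) = \<phi>l l j x"
    if "j < n" "x \<in> {0..1}" for l j x using data[OF that(1)] that(2) by blast
  define err where "err l t = L2_norm_n n (\<lambda>j x. wave n m ?A \<beta> W j (x, t) - wave n m ?A \<beta> (V l) j (x, t))" for l t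
  define err0 where "err0 l = L2_norm_n n (\<lambda>j x. \<phi>l l j x - ?\<phi> j x)" for l
  have est: "\<exists>C. \<forall>l. \<forall>t\<in>{0..T}. err l t \<le> C * err0 l" for T
  proof -
    have "\<exists>C\<ge>0. \<forall>W t. (\<forall>k<n. C1_profile (W k)) \<longrightarrow> t \<in> {0..T} \<longrightarrow>
      L2_norm_n n (\<lambda>j x. wave n m ?A \<beta> W j (x, t)) \<le>
      C * L2_norm_n n (\<lambda>j x. exp (- \<beta> j * travelled m j x) * W j (1 - travelled m j x))"
      by (rule wave_L2_estimate[OF \<open>0 < n\<close> \<beta>])
    then obtain C where C: "\<forall>W t. (\<forall>k<n. C1_profile (W k)) \<longrightarrow> t \<in> {0..T} \<longrightarrow>
      L2_norm_n n (\<lambda>j x. wave n m ?A \<beta> W j (x, t)) \<le>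
      C * L2_norm_n n (\<lambda>j x. exp (- \<beta> j * travelled m j x) * W j (1 - travelled m j x))"
      by (elim exE conjE)
    have "err l t \<le> C * err0 l" if t: "t \<in> {0..T}" for l t
    proof -
      let ?D = "\<lambda>k y. W k y - V l k y"
      have "err l t \<le> C * L2_norm_n n (\<lambda>j x. exp (- \<beta> j * travelled m j x) * ?D j (1 - travelled m j x))"
        unfolding err_def wave_diff
        by (rule C[rule_format, OF _ t]) (intro C1_profile_diff W V)
      also have "L2_norm_n n (\<lambda>j x. exp (- \<beta> j * travelled m j x) * ?D j (1 - travelled m j x)) = err0 l"
      proof -
        have "L2_norm (\<lambda>x. exp (- \<beta> j * travelled m j x) * ?D j (1 - travelled m j x))
          = L2_norm (\<lambda>x. \<phi>l l j x - ?\<phi> j x)" if j: "j < n" for j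
        proof -
          have "L2_norm (\<lambda>x. exp (- \<beta> j * travelled m j x) * ?D j (1 - travelled m j x))
            = L2_norm (\<lambda>x. ?\<phi> j x - \<phi>l l j x)"
            by (rule L2_norm_cong) (use V\<phi>[OF j, of _ l] in \<open>auto simp: right_diff_distrib\<close>)
          also have "\<dots> = L2_norm (\<lambda>x. \<phi>l l j x - ?\<phi> j x)"
            by (simp add: L2_norm_def power2_commute)
          finally show ?thesis .
        qed
        then show ?thesis
          unfolding L2_norm_n_def err0_def by (intro arg_cong[where f = Max] image_cong refl) simp
      qed
      finally show ?thesis .
    qed
    then show ?thesis by blast
  qed
  have uniform: "uniform_limit {0..T} err (\<lambda>t. 0) sequentially" for T
  proof (rule uniform_limitI)
    obtain C where C: "\<And>l t. t \<in> {0..T} \<Longrightarrow> err l t \<le> C * err0 l" using est by blast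
    have lim': "(\<lambda>l. C * err0 l) \<longlonglongrightarrow> 0"
      using tendsto_mult[OF tendsto_const[of C] lim] by (simp add: err0_def)
    fix e :: real assume "0 < e"
    with lim' have "\<forall>\<^sub>F l in sequentially. C * err0 l < e"
      by (intro order_tendstoD(2))
    then show "\<forall>\<^sub>F l in sequentially. \<forall>t\<in>{0..T}. dist (err l t) 0 < e"
    proof eventually_elim
      case (elim l)
      have "0 \<le> err l t" for t
        unfolding err_def by (rule order_trans[OF L2_norm_nonneg L2_norm_le_n[OF \<open>0 < n\<close>]])
      moreover have "err l t < e" if "t \<in> {0..T}" for t
        using C[OF that, of l] elim by linarith
      ultimately show ?case by simp
    qed
  qed
  have "classical_solution n m P (\<lambda>j _. unit_speed m j) (\<lambda>j _. \<beta> j) (\<phi>l l) (wave n m ?A \<beta> (V l))" for l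
    by (rule wave_classical_solution[where W = "V l", OF P mn V V\<phi>[symmetric]])
  then show "\<exists>ul. (\<forall>l. classical_solution n m P (\<lambda>j _. unit_speed m j) (\<lambda>j _. \<beta> j) (\<phi>l l) (ul l)) \<and>
     (\<forall>T>0. uniform_limit {0..T}
        (\<lambda>l t. L2_norm_n n (\<lambda>j x. wave n m ?A \<beta> W j (x, t) - ul l j (x, t))) (\<lambda>t. 0) sequentially)"
    using uniform unfolding err_def[abs_def] by (intro exI[of _ "\<lambda>l. wave n m ?A \<beta> (V l)"]) simp
qed

section \<open>Persistence in the recurrent case\<close>

text \<open>
  A single bump \<open>w\<close> entering in component \<open>k\<close> appears at the integer time \<open>s\<close> in component \<open>j\<close>
  with the factor $(A^s)_{jk}$, so this factor is zero once \<open>s\<close> exceeds the extinction time.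
\<close>

lemma damped_mat_nilpotent:
  assumes P: "P \<in> carrier_mat n n" and mn: "m \<le> n" and "0 < n"
    and \<beta>: "\<And>j. j < n \<Longrightarrow> 0 \<le> \<beta> j"
    and fts: "finite_time_stabilizable n m P (\<lambda>j _. unit_speed m j) (\<lambda>j _. \<beta> j)"
  shows "\<exists>s. \<forall>j<n. \<forall>k<n. (damped_mat n P \<beta> ^\<^sub>m s) $$ (j, k) = 0"
proof -
  let ?A = "damped_mat n P \<beta>"
  obtain Te where Te: "\<And>\<phi> u t j. (\<forall>j<n. L2_fun (\<phi> j)) \<Longrightarrow>
      L2_generalized_solution n m P (\<lambda>j _. unit_speed m j) (\<lambda>j _. \<beta> j) \<phi> u \<Longrightarrow> t > Te \<Longrightarrow> j < n \<Longrightarrow>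
      AE x in I01. u j (x, t) = 0"
    using fts unfolding finite_time_stabilizable_def by blast
  define s where "s = nat \<lceil>Te\<rceil> + 1"
  have s: "real s > Te" unfolding s_def by linarith
  have "C0_infinity (\<lambda>x. 1 * cutoff 3 x)"
    by (rule C0_infinity_cutoff) (auto intro: smooth_elem.intros)
  then obtain w w' where w': "\<And>x. (w has_real_derivative w' x) (at x)" "continuous_on UNIV w'"
    "\<And>x. x \<in> {0..1} \<Longrightarrow> w x = 1 * cutoff 3 x" "\<And>x. x \<notin> {0<..<1} \<Longrightarrow> w x = 0" "\<And>x. x \<notin> {0<..<1} \<Longrightarrow> w' x = 0"
    by (rule C0_infinity_extension) blast
  then have w: "C1_profile w" unfolding C1_profile_def by blast
  have w_half: "w (1/2) \<noteq> 0"
    using w'(3)[of "1/2"] by (simp add: cutoff_def flat_def)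
  have "(?A ^\<^sub>m s) $$ (j, k) = 0" if jk: "j < n" "k < n" for j k
  proof (rule ccontr)
    assume nz: "(?A ^\<^sub>m s) $$ (j, k) \<noteq> 0"
    define W where "W i = (if i = k then w else (\<lambda>_. 0))" for i
    have "C1_profile (\<lambda>_. 0)" unfolding C1_profile_def by (intro exI[of _ "\<lambda>_. 0"]) auto
    then have W: "C1_profile (W i)" for i using w by (simp add: W_def)
    define \<phi> where "\<phi> j x = exp (- \<beta> j * travelled m j x) * W j (1 - travelled m j x)" for j x
    have "L2_fun (\<phi> j)" for j
      unfolding \<phi>_def[abs_def]
      by (intro L2_fun_continuous continuous_intros continuous_on_compose2[OF C1_profile_continuous[OF W]]
          continuous_travelled) auto
    then have "AE x in I01. wave n m ?A \<beta> W j (x, real s) = 0"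
      using wave_generalized_solution[where W = W, OF P mn \<open>0 < n\<close> \<beta> W] s jk
      by (intro Te[of \<phi>]) (auto simp: \<phi>_def[abs_def])
    moreover have "wave n m ?A \<beta> W j (x, real s) \<noteq> 0" if "x \<in> {0<..<1}" "w (1 - travelled m j x) \<noteq> 0" for x
    proof -
      have r: "travelled m j x \<in> {0<..<1}" using that by (auto simp: travelled_def)
      have fl: "\<lfloor>real s - travelled m j x\<rfloor> = int s - 1" using r by (auto simp: floor_eq_iff)
      then have fr: "frac (real s - travelled m j x) = 1 - travelled m j x" by (simp add: frac_def)
      have "inflow_trace n ?A W j (real s - travelled m j x) = (\<Sum>i<n. if i = k then (?A ^\<^sub>m s) $$ (j, k) * w (1 - travelled m j x) else 0)"
        unfolding inflow_trace_def fl fr by (intro sum.cong) (auto simp: W_def)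
      also have "\<dots> = (?A ^\<^sub>m s) $$ (j, k) * w (1 - travelled m j x)" using jk by simp
      finally show ?thesis using nz that by (simp add: wave_def)
    qed
    ultimately have ae: "AE x in I01. w (1 - travelled m j x) = 0"
      by (auto simp: AE_restrict_space_iff elim: eventually_mono)
    define S where "S = {0<..<1} \<inter> (\<lambda>x. w (1 - travelled m j x)) -` (- {0})"
    have "continuous_on UNIV (\<lambda>x. w (1 - travelled m j x))"
      by (intro continuous_intros continuous_on_compose2[OF C1_profile_continuous[OF w]]
          continuous_travelled) auto
    then have "open S"
      unfolding S_def by (intro open_Int open_greaterThanLessThan open_vimage) auto
    moreover have "1/2 \<in> S" using w_half by (auto simp: S_def travelled_def)
    ultimately have "\<not> negligible S" using open_not_negligible by blast
    moreover have "AE x in lebesgue. x \<notin> S"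
      using ae by (auto simp: AE_restrict_space_iff S_def elim: eventually_mono)
    then have "S \<in> null_sets lebesgue"
      using \<open>open S\<close> by (subst AE_iff_null_sets) auto
    ultimately show False by (simp add: negligible_iff_null_sets)
  qed
  then show ?thesis by blast
qed

lemma power_entry_polynomial:
  fixes B C :: "real mat"
  shows "\<exists>p. \<forall>\<epsilon>. \<forall>j<n. \<forall>l<n.
    (mat n n (\<lambda>(j, k). B $$ (j, k) + \<epsilon> * C $$ (j, k)) ^\<^sub>m s) $$ (j, l) = poly (p j l) \<epsilon>"
proof (induction s)
  case 0
  show ?case by (intro exI[of _ "\<lambda>j l. if j = l then 1 else 0"]) auto
next
  case (Suc s)
  let ?Q = "\<lambda>\<epsilon>. mat n n (\<lambda>(j, k). B $$ (j, k) + \<epsilon> * C $$ (j, k))"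
  obtain p where p: "\<And>\<epsilon> j l. j < n \<Longrightarrow> l < n \<Longrightarrow> (?Q \<epsilon> ^\<^sub>m s) $$ (j, l) = poly (p j l) \<epsilon>"
    using Suc.IH by blast
  define q where "q j l = (\<Sum>k<n. [:B $$ (j, k), C $$ (j, k):] * p k l)" for j l
  have "(?Q \<epsilon> ^\<^sub>m Suc s) $$ (j, l) = poly (q j l) \<epsilon>" if "j < n" "l < n" for \<epsilon> j l
  proof -
    have "?Q \<epsilon> \<in> carrier_mat n n" by simp
    from pow_mat_Suc_left_entry[OF this that]
    show ?thesis using that p by (simp add: q_def poly_sum algebra_simps del: pow_mat.simps)
  qed
  then show ?case by blast
qed

text \<open>
  The damping gives the columns in a minimal recurrent set \<open>J\<close> the factor 1 and the other columns the
  factor \<open>\<epsilon>\<close>. In the limit \<open>\<epsilon> = 0\<close>, which is not the matrix of an admissible problem,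
  only the permutation of \<open>J\<close> by successors remains.
\<close>

lemma robust_FTS_imp_no_recurrent_set:
  assumes P: "P \<in> carrier_mat n n" and mn: "m \<le> n" and "0 < n"
    and rob: "robust_finite_time_stabilizable n m P"
  shows "\<not> (\<exists>J\<subseteq>{..<n}. recurrent_set P J)"
proof
  assume "\<exists>J\<subseteq>{..<n}. recurrent_set P J"
  then obtain J f where J: "J \<subseteq> {..<n}" "J \<noteq> {}" "bij_betw f J J"
    and f: "\<And>j k. j \<in> J \<Longrightarrow> k \<in> J \<Longrightarrow> P $$ (j, k) \<noteq> 0 \<longleftrightarrow> k = f j"
    by (rule minimal_recurrent_set) blast
  define B where "B = mat n n (\<lambda>(j, k). if k \<in> J then P $$ (j, k) else 0)"
  define C where "C = mat n n (\<lambda>(j, k). if k \<in> J then 0 else P $$ (j, k))"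
  define Q where "Q \<epsilon> = mat n n (\<lambda>(j, k). B $$ (j, k) + \<epsilon> * C $$ (j, k))" for \<epsilon>
  have nil: "\<exists>s. \<forall>j<n. \<forall>k<n. (Q \<epsilon> ^\<^sub>m s) $$ (j, k) = 0" if \<epsilon>: "\<epsilon> \<in> {0<..<1}" for \<epsilon>
  proof -
    define \<beta> where "\<beta> k = (if k \<in> J then 0 else - ln \<epsilon>)" for k
    have "Q \<epsilon> = damped_mat n P \<beta>"
      unfolding Q_def damped_mat_def B_def C_def \<beta>_def using \<epsilon> by (intro eq_matI) auto
    moreover have \<beta>: "0 \<le> \<beta> k" for k using \<epsilon> by (simp add: \<beta>_def)
    have const: "bounded_C1_strip (\<lambda>_. c)" for c
      unfolding bounded_C1_strip_def C1_strip_def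
      by (intro exI[of _ "\<lambda>_. 0"]) (auto simp: case_prod_unfold image_constant_conv)
    have "admissible n m (\<lambda>j _. unit_speed m j) (\<lambda>j _. \<beta> j)"
      unfolding admissible_def by (intro conjI exI[of _ 1]) (auto simp: const unit_speed_def)
    then have "finite_time_stabilizable n m P (\<lambda>j _. unit_speed m j) (\<lambda>j _. \<beta> j)"
      using rob by (simp add: robust_finite_time_stabilizable_def)
    from damped_mat_nilpotent[OF P mn \<open>0 < n\<close> \<beta> this] show ?thesis
      unfolding \<open>Q \<epsilon> = damped_mat n P \<beta>\<close> .
  qed
  define Z where "Z s = {\<epsilon>\<in>{0<..<1}. \<forall>j<n. \<forall>k<n. (Q \<epsilon> ^\<^sub>m s) $$ (j, k) = 0}" for s
  \<comment> \<open>Countably many exponents serve uncountably many \<open>\<epsilon>\<close>.\<close>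
  have "\<exists>s. infinite (Z s)"
  proof (rule ccontr)
    assume "\<nexists>s. infinite (Z s)"
    then have "countable (\<Union>s. Z s)" by (intro countable_UN) (auto intro: countable_finite)
    moreover have "{0<..<1} \<subseteq> (\<Union>s. Z s)" using nil by (auto simp: Z_def)
    ultimately have "countable {0<..<1 :: real}" by (rule countable_subset[rotated])
    then show False using uncountable_open_interval[of 0 "1 :: real"] by simp
  qed
  then obtain s where s: "infinite (Z s)" by blast
  obtain p where p: "\<And>\<epsilon> j l. j < n \<Longrightarrow> l < n \<Longrightarrow> (Q \<epsilon> ^\<^sub>m s) $$ (j, l) = poly (p j l) \<epsilon>"
    using power_entry_polynomial[of n B C s] unfolding Q_def by blast
  have zero: "(Q 0 ^\<^sub>m s) $$ (j, l) = 0" if "j < n" "l < n" for j l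
  proof -
    have "Z s \<subseteq> {\<epsilon>. poly (p j l) \<epsilon> = 0}"
      using that by (auto simp: Z_def p[OF that, symmetric])
    then have "infinite {\<epsilon>. poly (p j l) \<epsilon> = 0}" using s finite_subset by blast
    then have "p j l = 0" using poly_roots_finite by blast
    then show ?thesis using p[OF that, of 0] by simp
  qed
  have Q0: "Q 0 $$ (j, k) = (if k \<in> J then P $$ (j, k) else 0)" if "j < n" "k < n" for j k
    using that by (simp add: Q_def B_def)
  have fJ: "f j \<in> J" if "j \<in> J" for j using J(3) that by (auto simp: bij_betw_def)
  have "\<exists>l<n. (Q 0 ^\<^sub>m s) $$ (j, l) \<noteq> 0" if "j \<in> J" for s j
    using that
  proof (induction s arbitrary: j)
    case 0
    then show ?case using J(1) by (intro exI[of _ j]) (auto simp: Q_def)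
  next
    case (Suc s)
    obtain l where l: "l < n" "(Q 0 ^\<^sub>m s) $$ (f j, l) \<noteq> 0" using Suc.IH[OF fJ[OF Suc.prems]] by blast
    have j: "j < n" "f j < n" using Suc.prems fJ J(1) by auto
    have carr: "Q 0 \<in> carrier_mat n n" by (simp add: Q_def)
    have "(Q 0 ^\<^sub>m Suc s) $$ (j, l) = (\<Sum>k<n. Q 0 $$ (j, k) * (Q 0 ^\<^sub>m s) $$ (k, l))"
      by (rule pow_mat_Suc_left_entry[OF carr j(1) l(1)])
    also have "\<dots> = (\<Sum>k\<in>{f j}. Q 0 $$ (j, k) * (Q 0 ^\<^sub>m s) $$ (k, l))"
      by (rule sum.mono_neutral_right) (use j Q0 f[OF Suc.prems] in auto)
    also have "\<dots> \<noteq> 0" using l j Q0 f[OF Suc.prems fJ[OF Suc.prems]] fJ[OF Suc.prems] by simp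
    finally show ?case using l by blast
  qed
  moreover obtain j where "j \<in> J" using J(2) by blast
  ultimately show False using zero J(1) by blast
qed

section \<open>The equivalences\<close>

theorem theorem1p10:
  fixes n m :: nat and P P_abs :: "real mat"
  assumes "n \<ge> 2" and "m \<le> n" and "P \<in> carrier_mat n n"
    and "P_abs = map_mat abs P"
  shows "(robust_finite_time_stabilizable n m P \<longleftrightarrow>
            (\<forall>i \<in> {1..n + 1} \<rightarrow> {..<n}. (\<Prod>k=1..n. P $$ (i k, i (k + 1))) = 0)) \<and>
         ((\<forall>i \<in> {1..n + 1} \<rightarrow> {..<n}. (\<Prod>k=1..n. P $$ (i k, i (k + 1))) = 0) \<longleftrightarrow>
            (\<forall>J. J \<noteq> {} \<and> J \<subseteq> {..<n} \<longrightarrow> principal_minor P J = 0)) \<and>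
         ((\<forall>J. J \<noteq> {} \<and> J \<subseteq> {..<n} \<longrightarrow> principal_minor P J = 0) \<longleftrightarrow>
            nilpotent_mat P_abs \<and> P_abs ^\<^sub>m n = 0\<^sub>m n n)"
proof -
  let ?acyclic = "\<not> (\<exists>J\<subseteq>{..<n}. recurrent_set P J)"
  have n: "0 < n" using assms(1) by simp
  have walks: "(\<forall>i \<in> {1..n + 1} \<rightarrow> {..<n}. (\<Prod>k=1..n. P $$ (i k, i (k + 1))) = 0) \<longleftrightarrow> ?acyclic"
    unfolding recurrent_set_iff_walk by simp
  have minors: "(\<forall>J. J \<noteq> {} \<and> J \<subseteq> {..<n} \<longrightarrow> principal_minor P J = 0) \<longleftrightarrow> ?acyclic"
  proof
    assume minors: "\<forall>J. J \<noteq> {} \<and> J \<subseteq> {..<n} \<longrightarrow> principal_minor P J = 0"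
    show ?acyclic
    proof
      assume "\<exists>J\<subseteq>{..<n}. recurrent_set P J"
      then obtain J f where J: "J \<subseteq> {..<n}" "J \<noteq> {}" "bij_betw f J J"
        "\<And>j k. j \<in> J \<Longrightarrow> k \<in> J \<Longrightarrow> P $$ (j, k) \<noteq> 0 \<longleftrightarrow> k = f j"
        by (rule minimal_recurrent_set) blast
      then have "principal_minor P J \<noteq> 0"
        by (intro principal_minor_unique_successor[OF assms(3)])
      then show False using minors J by blast
    qed
  next
    assume ?acyclic
    then show "\<forall>J. J \<noteq> {} \<and> J \<subseteq> {..<n} \<longrightarrow> principal_minor P J = 0"
      using recurrent_set_of_principal_minor[OF assms(3)] by blast
  qed
  have power: "P_abs ^\<^sub>m n = 0\<^sub>m n n \<longleftrightarrow> ?acyclic"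
    unfolding assms(4) by (rule abs_power_eq_0_iff[OF assms(3)])
  have "nilpotent_mat P_abs" if "P_abs ^\<^sub>m n = 0\<^sub>m n n"
    unfolding nilpotent_mat_def using that n assms(3,4) by (intro exI[of _ n]) auto
  moreover have "robust_finite_time_stabilizable n m P \<longleftrightarrow> ?acyclic"
    using robust_FTS_imp_no_recurrent_set[OF assms(3,2) n] robust_FTS_of_nilpotent[OF assms(3,2) n]
      power assms(4) by blast
  ultimately show ?thesis using walks minors power by blast
qed

end
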